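(* Let $\Phi$ be a block tridiagonal quantum Markov chain on $\mathbb{Z}$ with internal space $\mathbb{C}^N$, with blocks $A_k,B_k,C_k\in M_{N^2}(\mathbb{C})$, $k\in\mathbb{Z}$, in positions $(k+1,k)$, $(k,k)$, $(k-1,k)$ respectively, and all other blocks zero. Assume that $A_n$ ($n\ge 0$) and $C_n$ ($n\le -1$) are nonsingular, and that there exist Hermitian matrices $(E_n)_{n\in\mathbb{Z}}$ and nonsingular matrices $(R_n)_{n\in\mathbb{Z}}$ in $M_{N^2}(\mathbb{C})$ with $$A_n^*R_{n+1}^*R_{n+1}=R_n^*R_nC_{n+1},\qquad R_{-n-1}^*R_{-n-1}C_{-n}=A_{-n-1}^*R_{-n}^*R_{-n}\qquad (n\ge 0),$$ and $R_nB_n=E_nR_n$ for all $n\in\mathbb{Z}$. Let $W=(W_{\alpha\beta})_{\alpha,\beta=1,2}$ be the spectral block matrix of $\Phi$, let $W_+$ and $W_-$ be weight matrices associated with the restrictions $\Phi^+$ of $\Phi$ to $\mathbb{Z}_{\ge 0}$ and $\Phi^-$ of $\Phi$ to $\mathbb{Z}_{<0}$, and put $$\Pi_0=(R_0^*R_0)^{-1},\quad \Pi_{-1}=(R_{-1}^*R_{-1})^{-1},\quad \Pi_0^+=\Big(\int_{\mathbb{R}}dW_+\Big)^{-1},\quad \Pi_{-1}^-=\Big(\int_{\mathbb{R}}dW_-\Big)^{-1}.$$ Then the Stieltjes transforms $B(z;\cdot)$ satisfy, for $z\in\mathbb{C}\setminus\mathbb{R}$, $$\begin{aligned} \Pi_0B(z;W_{11})&=\Pi_0^+B(z;W_+)\big(I-A_{-1}\Pi_{-1}^-B(z;W_-)C_0\Pi_0^+B(z;W_+)\big)^{-1},\\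 \Pi_{-1}B(z;W_{22})&=\Pi_{-1}^-B(z;W_-)\big(I-C_0\Pi_0^+B(z;W_+)A_{-1}\Pi_{-1}^-B(z;W_-)\big)^{-1},\\ \Pi_0B(z;W_{12})&=\Pi_0^+B(z;W_+)\big(I-A_{-1}\Pi_{-1}^-B(z;W_-)C_0\Pi_0^+B(z;W_+)\big)^{-1}A_{-1}\Pi_{-1}^-B(z;W_-),\\ \Pi_{-1}B(z;W_{21})&=\Pi_{-1}^-B(z;W_-)\big(I-C_0\Pi_0^+B(z;W_+)A_{-1}\Pi_{-1}^-B(z;W_-)\big)^{-1}C_0\Pi_0^+B(z;W_+). \end{aligned}$$
   Context: A quantum Markov chain (QMC) on a vertex set $V$ with internal space $\mathbb{C}^N$ is a block matrix $\Phi=(\Phi_{ij})_{i,j\in V}$ of completely positive maps $\Phi_{ij}$ on $M_N(\mathbb{C})$ such that each column sum $\sum_{i\in V}\Phi_{ij}$ is trace-preserving; each $\Phi_{ij}$ is identified with the $N^2\times N^2$ matrix $M$ satisfying $\mathrm{vec}(\Phi_{ij}(X))=M\,\mathrm{vec}(X)$, where $\mathrm{vec}$ stacks the rows of a matrix. $\Phi^{(n)}_{ji}$ denotes the $(j,i)$ block of $\Phi^n$. A weight matrix is a matrix of measures on $\mathbb{R}$ with finite moments which is positive semidefinite (its value on every Borel set is a positive semidefinite matrix). The Stieltjes transform is $B(z;W)=\int_{\mathbb{R}}\frac{dW(x)}{z-x}$. The polynomials $(Q^\alpha_n)_{n\in\mathbb{Z}}$, $\alpha=1,2$, are defined by $Q_0^1=Q_{-1}^2=I_{N^2}$,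 $Q_0^2=Q_{-1}^1=0$ and $xQ_n^\alpha=Q_{n+1}^\alpha A_n+Q_n^\alpha B_n+Q_{n-1}^\alpha C_n$, $n\in\mathbb{Z}$. The spectral block matrix of $\Phi$ is a $2N^2\times 2N^2$ weight matrix $W=(W_{\alpha\beta})_{\alpha,\beta=1,2}$, $W_{21}=W_{12}^*$, with $N^2\times N^2$ blocks, such that for all $i,j\in\mathbb{Z}$, $n\ge 0$, $$\Phi^{(n)}_{ji}=\sum_{\alpha,\beta=1}^2(R_j^*R_j)^{-1}\int_{\mathbb{R}}x^nQ_j^{\alpha}(x)^*\,dW_{\alpha\beta}(x)\,Q_i^\beta(x).$$ $\Phi^+=(\Phi_{ij})_{i,j\ge 0}$ and $\Phi^-=(\Phi_{ij})_{i,j\le -1}$. A weight matrix $W_+$ associated with $\Phi^+$ is an $N^2\times N^2$ weight matrix with $\int dW_+$ nonsingular for which the polynomials generated by $\Phi^+$ starting from $I$ at vertex $0$ are orthogonal; in particular $((\Phi^+)^n)_{00}=(\int dW_+)^{-1}\int x^n\,dW_+(x)$ for all $n\ge 0$. Likewise $W_-$ is associated with $\Phi^-$ with starting vertex $-1$, so that $((\Phi^-)^n)_{-1,-1}=(\int dW_-)^{-1}\int x^n\,dW_-(x)$ for all $n\ge 0$. *)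

theory Defs
  imports "HOL-Analysis.Analysis"
begin

section \<open>Matrices and completely positive maps\<close>

definition ctranspose :: "complex^'a^'b \<Rightarrow> complex^'b^'a" where
  "ctranspose M = (\<chi> i j. cnj (M $ j $ i))"

definition hermitian :: "complex^'m^'m \<Rightarrow> bool" where
  "hermitian M \<longleftrightarrow> ctranspose M = M"

text \<open>Over the complex numbers the condition below forces \<open>M\<close> to be Hermitian.\<close>

definition psd :: "complex^('m::finite)^'m \<Rightarrow> bool" where
  "psd M \<longleftrightarrow> (\<forall>v. (\<Sum>i\<in>UNIV. cnj (v $ i) * (M *v v) $ i) \<in> \<real>\<^sub>\<ge>\<^sub>0)"

text \<open>
  The space of \<open>N \<times> N\<close> matrices is \<open>complex^'n^'n\<close>.  The coordinates of a row-stacked matrix are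
  indexed by pairs (row, column), so that \<open>N\<^sup>2 \<times> N\<^sup>2\<close> matrices have type
  \<open>complex^('n \<times> 'n)^('n \<times> 'n)\<close>.
\<close>

type_synonym 'n supmat = "complex^('n \<times> 'n)^('n \<times> 'n)"

definition vec_rows :: "complex^'n^'n \<Rightarrow> complex^('n \<times> 'n)" where
  "vec_rows X = (\<chi> p. X $ fst p $ snd p)"

definition unvec_rows :: "complex^('n \<times> 'n) \<Rightarrow> complex^'n^'n" where
  "unvec_rows v = (\<chi> i j. v $ (i, j))"

definition superop :: "('n::finite) supmat \<Rightarrow> complex^'n^'n \<Rightarrow> complex^'n^'n" where
  "superop M X = unvec_rows (M *v vec_rows X)"

text \<open>
  A \<open>k \<times> k\<close> block matrix with blocks in \<open>complex^'n^'n\<close>; only the entries with indices below \<open>k\<close>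
  matter.
\<close>

definition block_psd :: "nat \<Rightarrow> (nat \<Rightarrow> nat \<Rightarrow> complex^('n::finite)^'n) \<Rightarrow> bool" where
  "block_psd k X \<longleftrightarrow> (\<forall>v :: nat \<Rightarrow> complex^'n.
     (\<Sum>a<k. \<Sum>b<k. \<Sum>i\<in>UNIV. cnj (v a $ i) * (X a b *v v b) $ i) \<in> \<real>\<^sub>\<ge>\<^sub>0)"

text \<open>Every amplification of the map represented by \<open>M\<close> to \<open>k \<times> k\<close> block matrices is positive.\<close>

definition completely_positive :: "('n::finite) supmat \<Rightarrow> bool" where
  "completely_positive M \<longleftrightarrow>
     (\<forall>k X. block_psd k X \<longrightarrow> block_psd k (\<lambda>a b. superop M (X a b)))"

definition trace_preserving :: "('n::finite) supmat \<Rightarrow> bool" where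
  "trace_preserving M \<longleftrightarrow> (\<forall>X. trace (superop M X) = trace X)"


section \<open>Quantum Markov chains\<close>

definition quantum_markov_chain :: "'v set \<Rightarrow> ('v \<Rightarrow> 'v \<Rightarrow> ('n::finite) supmat) \<Rightarrow> bool" where
  "quantum_markov_chain V \<Phi> \<longleftrightarrow>
     (\<forall>i\<in>V. \<forall>j\<in>V. completely_positive (\<Phi> i j)) \<and>
     (\<forall>j\<in>V. \<exists>S. ((\<lambda>i. \<Phi> i j) has_sum S) V \<and> trace_preserving S)"

definition block_tridiagonal ::
    "(int \<Rightarrow> ('n::finite) supmat) \<Rightarrow> (int \<Rightarrow> 'n supmat) \<Rightarrow> (int \<Rightarrow> 'n supmat)
       \<Rightarrow> int \<Rightarrow> int \<Rightarrow> 'n supmat" where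
  "block_tridiagonal A B C i j =
     (if i = j + 1 then A j else if i = j then B j else if i = j - 1 then C j else 0)"

fun block_power ::
    "'v set \<Rightarrow> ('v \<Rightarrow> 'v \<Rightarrow> ('n::finite) supmat) \<Rightarrow> nat \<Rightarrow> 'v \<Rightarrow> 'v \<Rightarrow> 'n supmat" where
  "block_power V \<Phi> 0 j i = (if j = i then mat 1 else 0)"
| "block_power V \<Phi> (Suc n) j i = (\<Sum>\<^sub>\<infinity>k\<in>V. \<Phi> j k ** block_power V \<Phi> n k i)"


section \<open>Complex measures on the real line and their integrals\<close>

definition complex_measure :: "(real set \<Rightarrow> complex) \<Rightarrow> bool" where
  "complex_measure \<mu> \<longleftrightarrow>
     (\<forall>F :: nat \<Rightarrow> real set. range F \<subseteq> sets borel \<longrightarrow> disjoint_family F \<longrightarrow>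
        (\<lambda>n. \<mu> (F n)) sums \<mu> (\<Union>n. F n))"

text \<open>
  The positive part in the Jordan decomposition of a finite signed Borel measure; the negative part
  is the positive part of the negated measure.  Negative values are sent to \<open>0\<close> by \<open>ennreal\<close>, which
  does not affect the supremum because the empty set contributes \<open>0\<close>.
\<close>

definition pos_variation :: "(real set \<Rightarrow> real) \<Rightarrow> real measure" where
  "pos_variation \<nu> =
     measure_of UNIV (sets borel) (\<lambda>E. SUP F\<in>{F \<in> sets borel. F \<subseteq> E}. ennreal (\<nu> F))"

definition neg_variation :: "(real set \<Rightarrow> real) \<Rightarrow> real measure" where
  "neg_variation \<nu> = pos_variation (\<lambda>E. - \<nu> E)"

definition cm_integrable :: "(real set \<Rightarrow> complex) \<Rightarrow> (real \<Rightarrow> complex) \<Rightarrow> bool" where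
  "cm_integrable \<mu> f \<longleftrightarrow>
     integrable (pos_variation (\<lambda>E. Re (\<mu> E))) f \<and> integrable (neg_variation (\<lambda>E. Re (\<mu> E))) f \<and>
     integrable (pos_variation (\<lambda>E. Im (\<mu> E))) f \<and> integrable (neg_variation (\<lambda>E. Im (\<mu> E))) f"

definition cm_integral :: "(real set \<Rightarrow> complex) \<Rightarrow> (real \<Rightarrow> complex) \<Rightarrow> complex" where
  "cm_integral \<mu> f =
     (integral\<^sup>L (pos_variation (\<lambda>E. Re (\<mu> E))) f - integral\<^sup>L (neg_variation (\<lambda>E. Re (\<mu> E))) f)
     + \<i> * (integral\<^sup>L (pos_variation (\<lambda>E. Im (\<mu> E))) f - integral\<^sup>L (neg_variation (\<lambda>E. Im (\<mu> E))) f)"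


section \<open>Weight matrices\<close>

definition weight_matrix :: "(real set \<Rightarrow> complex^('m::finite)^'m) \<Rightarrow> bool" where
  "weight_matrix W \<longleftrightarrow>
     (\<forall>a b. complex_measure (\<lambda>E. W E $ a $ b)) \<and>
     (\<forall>a b. \<forall>k::nat. cm_integrable (\<lambda>E. W E $ a $ b) (\<lambda>x. of_real (x ^ k))) \<and>
     (\<forall>E\<in>sets borel. psd (W E))"

definition mat_integral ::
    "(real set \<Rightarrow> complex^'a^'b) \<Rightarrow> (real \<Rightarrow> complex) \<Rightarrow> complex^'a^'b" where
  "mat_integral W f = (\<chi> a b. cm_integral (\<lambda>E. W E $ a $ b) f)"

text \<open>The integral of \<open>F(x) dW(x) G(x)\<close> for matrix-valued \<open>F\<close> and \<open>G\<close>.\<close>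

definition sandwich_integral ::
    "(real \<Rightarrow> complex^('m::finite)^'m) \<Rightarrow> (real set \<Rightarrow> complex^'m^'m) \<Rightarrow> (real \<Rightarrow> complex^'m^'m)
       \<Rightarrow> complex^'m^'m" where
  "sandwich_integral F W G =
     (\<chi> a b. \<Sum>c\<in>UNIV. \<Sum>d\<in>UNIV.
        cm_integral (\<lambda>E. W E $ c $ d) (\<lambda>x. F x $ a $ c * G x $ d $ b))"

definition stieltjes :: "complex \<Rightarrow> (real set \<Rightarrow> complex^'m^'m) \<Rightarrow> complex^'m^'m" where
  "stieltjes z W = mat_integral W (\<lambda>x. 1 / (z - of_real x))"

definition wblock ::
    "(real set \<Rightarrow> complex^(2 \<times> 'm)^(2 \<times> 'm)) \<Rightarrow> 2 \<Rightarrow> 2 \<Rightarrow> real set \<Rightarrow> complex^'m^'m" where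
  "wblock W \<alpha> \<beta> E = (\<chi> a b. W E $ (\<alpha>, a) $ (\<beta>, b))"


section \<open>Polynomials, the spectral block matrix, and weight matrices of restrictions\<close>

text \<open>
  Matrix polynomials are represented by their values on the real line.  If \<open>A n\<close> (\<open>n \<ge> 0\<close>) and
  \<open>C n\<close> (\<open>n \<le> -1\<close>) are nonsingular, exactly one family satisfies the following conditions, and it
  consists of polynomials.
\<close>

definition two_sided_polys ::
    "(int \<Rightarrow> ('n::finite) supmat) \<Rightarrow> (int \<Rightarrow> 'n supmat) \<Rightarrow> (int \<Rightarrow> 'n supmat)
       \<Rightarrow> (2 \<Rightarrow> int \<Rightarrow> real \<Rightarrow> 'n supmat) \<Rightarrow> bool" where
  "two_sided_polys A B C Q \<longleftrightarrow>
     (\<forall>x. Q 1 0 x = mat 1 \<and> Q 2 (-1) x = mat 1 \<and> Q 2 0 x = 0 \<and> Q 1 (-1) x = 0) \<and>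
     (\<forall>\<alpha> n x. x *\<^sub>R Q \<alpha> n x = Q \<alpha> (n + 1) x ** A n + Q \<alpha> n x ** B n + Q \<alpha> (n - 1) x ** C n)"

definition spectral_block_matrix ::
    "(int \<Rightarrow> ('n::finite) supmat) \<Rightarrow> (int \<Rightarrow> 'n supmat) \<Rightarrow> (int \<Rightarrow> 'n supmat) \<Rightarrow> (int \<Rightarrow> 'n supmat)
       \<Rightarrow> (real set \<Rightarrow> complex^(2 \<times> 'n \<times> 'n)^(2 \<times> 'n \<times> 'n)) \<Rightarrow> bool" where
  "spectral_block_matrix A B C R W \<longleftrightarrow>
     weight_matrix W \<and>
     (\<forall>E\<in>sets borel. wblock W 2 1 E = ctranspose (wblock W 1 2 E)) \<and>
     (\<exists>Q. two_sided_polys A B C Q \<and>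
        (\<forall>i j n. block_power UNIV (block_tridiagonal A B C) n j i =
           (\<Sum>\<alpha>\<in>UNIV. \<Sum>\<beta>\<in>UNIV. matrix_inv (ctranspose (R j) ** R j) **
              sandwich_integral (\<lambda>x. (x ^ n) *\<^sub>R ctranspose (Q \<alpha> j x)) (wblock W \<alpha> \<beta>)
                (\<lambda>x. Q \<beta> i x))))"

text \<open>
  The polynomials generated by the restriction of \<open>\<Phi>\<close> to \<open>V\<close>, starting from the identity at \<open>v\<close>:
  the row \<open>(P n)\<close>, \<open>n \<in> V\<close>, is a left eigenvector of this restriction with eigenvalue \<open>x\<close>.
\<close>

definition generated_polys ::
    "int set \<Rightarrow> (int \<Rightarrow> int \<Rightarrow> ('n::finite) supmat) \<Rightarrow> int \<Rightarrow> (int \<Rightarrow> real \<Rightarrow> 'n supmat) \<Rightarrow> bool" where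
  "generated_polys V \<Phi> v P \<longleftrightarrow>
     (\<forall>x. P v x = mat 1) \<and>
     (\<forall>n\<in>V. \<forall>x. x *\<^sub>R P n x = (\<Sum>\<^sub>\<infinity>m\<in>V. P m x ** \<Phi> m n))"

definition associated_weight ::
    "int set \<Rightarrow> (int \<Rightarrow> int \<Rightarrow> ('n::finite) supmat) \<Rightarrow> int \<Rightarrow> (real set \<Rightarrow> 'n supmat) \<Rightarrow> bool" where
  "associated_weight V \<Phi> v W \<longleftrightarrow>
     weight_matrix W \<and> invertible (mat_integral W (\<lambda>_. 1)) \<and>
     (\<exists>P. generated_polys V \<Phi> v P \<and>
        (\<forall>i\<in>V. \<forall>j\<in>V. i \<noteq> j \<longrightarrow>
           sandwich_integral (\<lambda>x. ctranspose (P i x)) W (\<lambda>x. P j x) = 0))"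

end

theory Submission
  imports Defs "HOL-Complex_Analysis.Conformal_Mappings"
begin

text \<open>
  Complete positivity and trace preservation bound the blocks of \<open>\<Phi>\<^sup>n\<close>, and of the powers of its
  restrictions, uniformly in \<open>n\<close>.  All weight matrices therefore have bounded moments, hence bounded
  support, and their Stieltjes transforms are, near infinity, generating functions of block powers.
  Decomposing the paths of the chain at their first passage from one half-line to the other gives
  \<open>X\<^bsub>00\<^esub> = G\<^sub>+ + X\<^bsub>0,-1\<^esub> C\<^sub>0 G\<^sub>+\<close> and \<open>X\<^bsub>0,-1\<^esub> = X\<^bsub>00\<^esub> A\<^bsub>-1\<^esub> G\<^sub>-\<close>, and symmetrically, for these generating functions;
  analytic continuation extends the identities to all nonreal \<open>z\<close>.  They also produce inverses of the
  two matrices \<open>I - \<dots>\<close>, so that the system can be solved.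
\<close>

section \<open>Positive semidefinite matrices\<close>

text \<open>Finite moments alone neither determine a measure nor allow \<open>1 / (z - x)\<close> to
  be expanded at infinity under the integral. The uniform bound on block powers closes this gap: the
  diagonal entries of a weight matrix are positive measures, so bounded moments keep them away from
  \<open>{x. 2 \<le> \<bar>x\<bar>}\<close>, and positive semidefiniteness passes this on to the
  other entries. The expansions then converge absolutely for large \<open>z\<close>, and
  convolutions of block powers become products of transforms.

  Paths are cut at the first exit from the half-line in which they start. Blocks compose from right
  to left, so restricted powers end up on the right, and elimination of the off-diagonal blocks
  leaves equations \<open>X = G + X ** M\<close>; this is why the inverse in the result stands on
  the right. Solving them requires \<open>mat 1 - M\<close> to be invertible at every nonreal
  \<open>z\<close>, whereas a Neumann series would reach only large \<open>z\<close>. The remedy is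
  crossed: the block at one vertex yields the inverse for the other vertex.\<close>

text \<open>The quadratic form at the vector with 1 at \<open>a\<close> and \<open>c\<close> at
  \<open>b\<close>, the two contributions being added so that \<open>a = b\<close> is covered
  too.\<close>

lemma psd_form:
  fixes M :: "complex^('m::finite)^'m"
  assumes "psd M"
  shows "M $ a $ a + c * M $ a $ b + cnj c * M $ b $ a + cnj c * c * M $ b $ b \<in> \<real>\<^sub>\<ge>\<^sub>0"
proof -
  define v :: "complex^'m" where "v = (\<chi> i. (if i = a then 1 else 0) + (if i = b then c else 0))"
  have mv: "(M *v v) $ i = M $ i $ a + M $ i $ b * c" for i
  proof -
    have "(M *v v) $ i = (\<Sum>j\<in>UNIV. (if j = a then M $ i $ j else 0) + (if j = b then M $ i $ j * c else 0))"
      unfolding matrix_vector_mult_def by (auto simp: v_def algebra_simps intro!: sum.cong)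
    then show ?thesis by (simp add: sum.distrib)
  qed
  have "(\<Sum>i\<in>UNIV. cnj (v $ i) * (M *v v) $ i) =
      (\<Sum>i\<in>UNIV. (if i = a then (M *v v) $ i else 0) + (if i = b then cnj c * (M *v v) $ i else 0))"
    by (rule sum.cong) (auto simp: v_def algebra_simps)
  also have "\<dots> = (M *v v) $ a + cnj c * (M *v v) $ b"
    by (simp add: sum.distrib)
  also have "\<dots> = M $ a $ a + c * M $ a $ b + cnj c * M $ b $ a + cnj c * c * M $ b $ b"
    by (simp add: mv algebra_simps)
  finally show ?thesis
    using assms unfolding psd_def by metis
qed

lemma psd_diag:
  assumes "psd M"
  shows "M $ a $ a \<in> \<real>\<^sub>\<ge>\<^sub>0"
  using psd_form[OF assms, of a 0 a] by simp

text \<open>Polarisation with \<open>c\<close> running through 1, -1, \<i>, -\<i>. It has two uses: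
  zero diagonal entries force zero entries elsewhere, and a bound on the trace bounds every
  entry.\<close>

lemma psd_entry_bound:
  assumes "psd M"
  shows "cmod (M $ a $ b) \<le> Re (M $ a $ a) + Re (M $ b $ b)"
proof -
  note f = psd_form[OF assms, of a _ b, unfolded complex_nonneg_Reals_iff]
  define s where "s = M $ a $ b + M $ b $ a"
  define d where "d = \<i> * (M $ a $ b - M $ b $ a)"
  let ?t = "Re (M $ a $ a) + Re (M $ b $ b)"
  have di: "Im (M $ a $ a) = 0" "Im (M $ b $ b) = 0"
    using psd_diag[OF assms] by (auto simp: complex_nonneg_Reals_iff)
  have "Im s = 0" "\<bar>Re s\<bar> \<le> ?t" "Im d = 0" "\<bar>Re d\<bar> \<le> ?t"
    using f[of 1] f[of "-1"] f[of \<i>] f[of "-\<i>"] di unfolding s_def d_def by auto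
  then have s: "cmod s \<le> ?t" "cmod d \<le> ?t"
    by (simp_all add: cmod_eq_Re)
  have "2 * M $ a $ b = s - \<i> * d"
    by (simp add: s_def d_def algebra_simps)
  then have "cmod (2 * M $ a $ b) \<le> cmod s + cmod (\<i> * d)"
    by (metis norm_triangle_ineq4)
  with s show ?thesis by (simp add: norm_mult)
qed

lemma psd_trace:
  assumes "psd M"
  shows "Re (M $ a $ a) \<le> Re (trace M)" "0 \<le> Re (trace M)"
proof -
  have nn: "0 \<le> Re (M $ i $ i)" for i
    using psd_diag[OF assms] by (auto simp: complex_nonneg_Reals_iff)
  then show "Re (M $ a $ a) \<le> Re (trace M)"
    unfolding trace_def Re_sum by (intro member_le_sum) auto
  show "0 \<le> Re (trace M)"
    unfolding trace_def Re_sum by (intro sum_nonneg) (auto simp: nn)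
qed

text \<open>The form at \<open>v\<close> is the squared modulus of the inner product of
  \<open>x\<close> and \<open>v\<close>. These matrices serve as test inputs for positive
  maps.\<close>

lemma psd_rank_one: "psd (\<chi> i j. x $ i * cnj (x $ j))"
  unfolding psd_def
proof
  fix v :: "complex^'a"
  define s where "s = (\<Sum>j\<in>UNIV. cnj (x $ j) * v $ j)"
  have "((\<chi> i j. x $ i * cnj (x $ j)) *v v) $ i = x $ i * s" for i
    by (simp add: matrix_vector_mult_def s_def sum_distrib_left mult.assoc)
  then have "(\<Sum>i\<in>UNIV. cnj (v $ i) * ((\<chi> i j. x $ i * cnj (x $ j)) *v v) $ i)
      = (\<Sum>i\<in>UNIV. cnj (v $ i) * x $ i) * s"
    by (simp add: sum_distrib_right mult.assoc)
  also have "(\<Sum>i\<in>UNIV. cnj (v $ i) * x $ i) = cnj s"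
    by (simp add: s_def mult.commute)
  also have "cnj s * s = of_real ((cmod s)\<^sup>2)"
    using complex_norm_square[of s] by (simp add: mult.commute)
  finally show "(\<Sum>i\<in>UNIV. cnj (v $ i) * ((\<chi> i j. x $ i * cnj (x $ j)) *v v) $ i) \<in> \<real>\<^sub>\<ge>\<^sub>0"
    by (simp add: complex_nonneg_Reals_iff)
qed

section \<open>Complex measures\<close>

lemma sets_pos_variation [simp]: "sets (pos_variation \<nu>) = sets borel"
  and space_pos_variation [simp]: "space (pos_variation \<nu>) = UNIV"
  unfolding pos_variation_def
  using sets.sigma_sets_eq[of "borel :: real measure"] by (auto simp: sets_measure_of space_measure_of)

text \<open>Only an inequality, but valid for every set function: where the supremum does not define
  a measure, \<open>measure_of\<close> assigns 0.\<close>

lemma emeasure_pos_variation_le: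
  "emeasure (pos_variation \<nu>) E \<le> (SUP F\<in>{F \<in> sets borel. F \<subseteq> E}. ennreal (\<nu> F))"
  unfolding pos_variation_def by (subst emeasure_measure_of_conv) auto

lemma emeasure_pos_variation_eq_0:
  assumes "\<And>F. F \<in> sets borel \<Longrightarrow> F \<subseteq> E \<Longrightarrow> \<nu> F \<le> 0"
  shows "emeasure (pos_variation \<nu>) E = 0"
proof -
  have "(SUP F\<in>{F \<in> sets borel. F \<subseteq> E}. ennreal (\<nu> F)) \<le> 0"
    by (rule SUP_least) (auto simp: assms ennreal_neg)
  with emeasure_pos_variation_le[of \<nu> E] show ?thesis by auto
qed

lemma integral_pos_variation_eq_0:
  fixes f :: "real \<Rightarrow> complex"
  assumes "\<And>F. F \<in> sets borel \<Longrightarrow> \<nu> F \<le> 0"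
  shows "integral\<^sup>L (pos_variation \<nu>) f = 0"
proof -
  have "UNIV \<in> null_sets (pos_variation \<nu>)"
    by (intro null_setsI emeasure_pos_variation_eq_0 assms) auto
  then have "AE x in pos_variation \<nu>. f x = 0"
    by (rule AE_I') auto
  then show ?thesis by (rule integral_eq_zero_AE)
qed

definition jordan_parts :: "(real set \<Rightarrow> complex) \<Rightarrow> real measure set" where
  "jordan_parts \<mu> = {pos_variation (\<lambda>E. Re (\<mu> E)), neg_variation (\<lambda>E. Re (\<mu> E)),
     pos_variation (\<lambda>E. Im (\<mu> E)), neg_variation (\<lambda>E. Im (\<mu> E))}"

lemma jordan_parts_borel:
  assumes "p \<in> jordan_parts \<mu>"
  shows "sets p = sets borel" "space p = UNIV"
  using assms by (auto simp: jordan_parts_def neg_variation_def)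

lemma cm_integrable_iff: "cm_integrable \<mu> f \<longleftrightarrow> (\<forall>p\<in>jordan_parts \<mu>. integrable p f)"
  by (auto simp: cm_integrable_def jordan_parts_def)

lemma cm_integral_add:
  assumes "cm_integrable \<mu> f" "cm_integrable \<mu> g"
  shows "cm_integral \<mu> (\<lambda>x. f x + g x) = cm_integral \<mu> f + cm_integral \<mu> g"
  using assms by (simp add: cm_integral_def cm_integrable_def algebra_simps)

lemma cm_integral_0 [simp]: "cm_integral \<mu> (\<lambda>x. 0) = 0"
  and cm_integrable_0 [simp]: "cm_integrable \<mu> (\<lambda>x. 0)"
  by (simp_all add: cm_integral_def cm_integrable_def)

lemma cm_integral_mult_right: "cm_integral \<mu> (\<lambda>x. f x * c) = cm_integral \<mu> f * c"
  by (simp add: cm_integral_def algebra_simps)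

lemma cm_integrable_mult_right:
  "cm_integrable \<mu> f \<Longrightarrow> cm_integrable \<mu> (\<lambda>x. f x * c)"
  by (simp add: cm_integrable_def)

lemma cm_integrable_sum:
  "(\<And>i. i \<in> I \<Longrightarrow> cm_integrable \<mu> (f i)) \<Longrightarrow> cm_integrable \<mu> (\<lambda>x. \<Sum>i\<in>I. f i x)"
  by (simp add: cm_integrable_def)

lemma cm_integral_sum:
  assumes "\<And>i. i \<in> I \<Longrightarrow> cm_integrable \<mu> (f i)"
  shows "cm_integral \<mu> (\<lambda>x. \<Sum>i\<in>I. f i x) = (\<Sum>i\<in>I. cm_integral \<mu> (f i))"
  using assms
proof (induction I rule: infinite_finite_induct)
  case (insert i I)
  then show ?case by (simp add: cm_integral_add cm_integrable_sum)
qed auto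

text \<open>Monotonicity makes the supremum over Borel subsets equal to the value itself, and the
  other three Jordan parts integrate everything to 0.\<close>

lemma nonneg_complex_measure:
  assumes "complex_measure \<mu>" and nn: "\<And>E. E \<in> sets borel \<Longrightarrow> \<mu> E \<in> \<real>\<^sub>\<ge>\<^sub>0"
  defines "N \<equiv> pos_variation (\<lambda>E. Re (\<mu> E))"
  shows "\<And>E. E \<in> sets borel \<Longrightarrow> emeasure N E = ennreal (Re (\<mu> E))"
    and "\<And>f. cm_integral \<mu> f = integral\<^sup>L N f"
proof -
  let ?f = "\<lambda>E. ennreal (Re (\<mu> E))"
  have re: "0 \<le> Re (\<mu> E)" "Im (\<mu> E) = 0" if "E \<in> sets borel" for E
    using nn[OF that] by (auto simp: complex_nonneg_Reals_iff)
  have sm: "(\<lambda>n. \<mu> (F n)) sums \<mu> (\<Union>n. F n)"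
    if "range F \<subseteq> sets borel" "disjoint_family F" for F :: "nat \<Rightarrow> real set"
    using assms(1) that unfolding complex_measure_def by blast
  \<comment> \<open>Countable additivity for the constant empty family: a convergent constant series
    has zero terms.\<close>
  have "(\<lambda>n::nat. \<mu> {}) sums \<mu> {}"
    using sm[of "\<lambda>_. {}"] by (simp add: disjoint_family_on_def)
  then have e0: "\<mu> {} = 0"
    using sums_summable summable_LIMSEQ_zero LIMSEQ_const_iff by blast
  \<comment> \<open>The real part is first made into a genuine measure, whose monotonicity then
    evaluates the supremum in \<open>pos_variation\<close>.\<close>
  define M where "M = measure_of UNIV (sets borel) ?f"
  have sets_M: "sets M = sets borel"
    unfolding M_def using sets.sigma_sets_eq[of "borel :: real measure"] by (auto simp: sets_measure_of)
  have ms: "measure_space UNIV (sets borel) ?f"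
    unfolding measure_space_def
  proof (intro conjI)
    show "sigma_algebra UNIV (sets (borel :: real measure))"
      using sets.sigma_algebra_axioms[of "borel :: real measure"] by simp
    show "positive (sets borel) ?f"
      by (simp add: positive_def e0)
    show "countably_additive (sets borel) ?f"
      unfolding countably_additive_def
    proof (intro allI impI)
      fix F :: "nat \<Rightarrow> real set"
      assume F: "range F \<subseteq> sets borel" "disjoint_family F"
      show "(\<Sum>n. ennreal (Re (\<mu> (F n)))) = ennreal (Re (\<mu> (\<Union>n. F n)))"
        by (rule suminf_ennreal_eq[OF _ sums_Re[OF sm[OF F]]]) (use F re in auto)
    qed
  qed
  have eM: "emeasure M E = ?f E" if "E \<in> sets borel" for E
    unfolding M_def using ms that sets.sigma_sets_eq[of "borel :: real measure"]
    by (subst emeasure_measure_of_conv) auto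
  have "N = M"
    unfolding N_def pos_variation_def M_def
  proof (rule measure_of_eq)
    fix X :: "real set" assume "X \<in> sigma_sets UNIV (sets borel)"
    then have X: "X \<in> sets borel"
      using sets.sigma_sets_eq[of "borel :: real measure"] by simp
    have "?f F \<le> ?f X" if "F \<in> sets borel" "F \<subseteq> X" for F
      using emeasure_mono[of F X M] that X by (simp add: eM sets_M)
    then show "(SUP F\<in>{F \<in> sets borel. F \<subseteq> X}. ?f F) = ?f X"
      using X by (intro antisym SUP_least SUP_upper) auto
  qed auto
  then show "\<And>E. E \<in> sets borel \<Longrightarrow> emeasure N E = ennreal (Re (\<mu> E))"
    by (simp add: eM)
  show "cm_integral \<mu> f = integral\<^sup>L N f" for f
    unfolding cm_integral_def neg_variation_def N_def
    by (simp add: integral_pos_variation_eq_0 re)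
qed

section \<open>Bounded moments force bounded support\<close>

lemma integrable_1_imp_finite_measure:
  assumes "integrable M (\<lambda>x. 1 :: complex)"
  shows "finite_measure M"
  using assms by (intro finite_measureI) (auto simp: integrable_iff_bounded)

text \<open>Chebyshev with even powers: the moment of order \<open>2 * n\<close> is at least
  \<open>4 ^ n\<close> times the mass of the set, which bounded moments allow only for mass
  0.\<close>

lemma bounded_moments_emeasure_0:
  fixes N :: "real measure"
  assumes "sets N = sets borel"
    and int: "\<And>k. integrable N (\<lambda>x. complex_of_real (x ^ k))"
    and bd: "\<And>k. cmod (\<integral>x. complex_of_real (x ^ k) \<partial>N) \<le> K"
  shows "emeasure N {x. 2 \<le> \<bar>x\<bar>} = 0"
proof -
  let ?E = "{x::real. 2 \<le> \<bar>x\<bar>}"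
  have E [measurable]: "?E \<in> sets N"
    unfolding assms(1) by measurable
  have fin: "finite_measure N"
    using integrable_1_imp_finite_measure int[of 0] by simp
  interpret finite_measure N by fact
  have ir: "integrable N (\<lambda>x. x ^ k)" for k
    using integrable_Re[OF int[of k]] by simp
  have "measure N ?E * 4 ^ n \<le> K" for n
  proof -
    have "measure N ?E * 4 ^ n = (\<integral>x. indicator ?E x * 4 ^ n \<partial>N)"
      by (simp add: E)
    also have "\<dots> \<le> (\<integral>x. x ^ (2 * n) \<partial>N)"
    proof (rule integral_mono)
      show "integrable N (\<lambda>x. indicator ?E x * 4 ^ n :: real)"
        by (intro integrable_mult_left integrable_real_indicator E) (simp add: less_top[symmetric])
      show "indicator ?E x * 4 ^ n \<le> x ^ (2 * n)" for x :: real
      proof (cases "x \<in> ?E")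
        case True
        then have "(2::real)\<^sup>2 \<le> \<bar>x\<bar>\<^sup>2"
          by (intro power_mono) auto
        then have "4 ^ n \<le> (x\<^sup>2) ^ n"
          by (intro power_mono) auto
        then show ?thesis using True by (simp add: power_mult)
      qed (simp add: power_mult)
    qed (use ir in auto)
    also have "\<dots> = Re (\<integral>x. complex_of_real (x ^ (2 * n)) \<partial>N)"
      by (subst integral_complex_of_real) simp
    also have "\<dots> \<le> K"
      using bd[of "2 * n"] complex_Re_le_cmod order_trans by blast
    finally show ?thesis .
  qed
  then have "measure N ?E = 0"
  proof -
    assume *: "\<And>n. measure N ?E * 4 ^ n \<le> K"
    show ?thesis
    proof (rule ccontr)
      assume "measure N ?E \<noteq> 0"
      then have m: "0 < measure N ?E" by (simp add: less_le)
      obtain n where "K / measure N ?E < 4 ^ n"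
        using real_arch_pow[of 4 "K / measure N ?E"] by auto
      then have "K < measure N ?E * 4 ^ n"
        using m by (simp add: field_simps)
      with *[of n] show False by simp
    qed
  qed
  then show ?thesis by (simp add: emeasure_eq_measure)
qed

text \<open>
  The radius 2 is an arbitrary bound exceeding 1: bounded moments confine the support to
  \<open>[-1, 1]\<close>, but any bounded support suffices to expand the Stieltjes transform at infinity.
\<close>

definition supported_in_2 :: "(real set \<Rightarrow> complex) \<Rightarrow> bool" where
  "supported_in_2 \<mu> \<longleftrightarrow> (\<forall>p\<in>jordan_parts \<mu>. finite_measure p \<and> (AE x in p. \<bar>x\<bar> < 2))"

lemma weight_matrix_supported:
  assumes W: "weight_matrix W"
    and bd: "\<And>a k. cmod (mat_integral W (\<lambda>x. of_real (x ^ k)) $ a $ a) \<le> K"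
  shows "supported_in_2 (\<lambda>E. W E $ a $ b)"
  unfolding supported_in_2_def
proof (intro ballI conjI)
  fix p assume p: "p \<in> jordan_parts (\<lambda>E. W E $ a $ b)"
  have cm: "complex_measure (\<lambda>E. W E $ a $ b)"
    and int: "cm_integrable (\<lambda>E. W E $ a $ b) (\<lambda>x. of_real (x ^ k))" for a b k
    using W by (auto simp: weight_matrix_def)
  have psd: "psd (W E)" if "E \<in> sets borel" for E
    using W that by (auto simp: weight_matrix_def)
  have "integrable p (\<lambda>x. 1::complex)"
    using int[of a b 0] p by (simp add: cm_integrable_iff)
  then show "finite_measure p"
    by (rule integrable_1_imp_finite_measure)
  let ?E = "{x::real. 2 \<le> \<bar>x\<bar>}"
  have E: "?E \<in> sets borel" by measurable
  \<comment> \<open>Diagonal entries are positive measures, which makes bounds on their moments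
    conclusive; the other entries follow by \<open>psd_entry_bound\<close>.\<close>
  have diag: "Re (W F $ c $ c) = 0" if "F \<in> sets borel" "F \<subseteq> ?E" for F c
  proof -
    define N where "N = pos_variation (\<lambda>E. Re (W E $ c $ c))"
    have N: "emeasure N E = ennreal (Re (W E $ c $ c))" if "E \<in> sets borel" for E
      unfolding N_def using that by (intro nonneg_complex_measure cm psd_diag psd)
    have N_int: "cm_integral (\<lambda>E. W E $ c $ c) f = integral\<^sup>L N f" for f
      unfolding N_def by (intro nonneg_complex_measure cm psd_diag psd)
    have "emeasure N ?E = 0"
    proof (rule bounded_moments_emeasure_0)
      show "sets N = sets borel" by (simp add: N_def)
      show "integrable N (\<lambda>x. complex_of_real (x ^ k))" for k
        using int[of c c k] by (simp add: cm_integrable_def N_def)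
      show "cmod (\<integral>x. complex_of_real (x ^ k) \<partial>N) \<le> K" for k
        using bd[of k c] by (simp add: mat_integral_def N_int)
    qed
    moreover have "emeasure N F \<le> emeasure N ?E"
      by (rule emeasure_mono) (use that E in \<open>auto simp: N_def\<close>)
    ultimately have "ennreal (Re (W F $ c $ c)) = 0"
      using N[OF that(1)] by simp
    then show ?thesis
      using psd_diag[OF psd[OF that(1)], of c] by (simp add: complex_nonneg_Reals_iff)
  qed
  have z: "W F $ a $ b = 0" if "F \<in> sets borel" "F \<subseteq> ?E" for F
    using psd_entry_bound[OF psd[OF that(1)], of a b] diag[OF that] by simp
  have "emeasure p ?E = 0"
    using p z by (auto simp: jordan_parts_def neg_variation_def emeasure_pos_variation_eq_0)
  then have "?E \<in> null_sets p"
    using E jordan_parts_borel[OF p] by (intro null_setsI) auto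
  then show "AE x in p. \<bar>x\<bar> < 2"
    by (rule AE_I') auto
qed

section \<open>Stieltjes transforms\<close>

text \<open>Absolute convergence is carried along with the value because the Cauchy product relies
  on it.\<close>

definition abs_sums :: "(nat \<Rightarrow> complex) \<Rightarrow> complex \<Rightarrow> bool" where
  "abs_sums f s \<longleftrightarrow> summable (\<lambda>n. norm (f n)) \<and> f sums s"

lemma abs_sums_add:
  assumes "abs_sums f s" "abs_sums g t"
  shows "abs_sums (\<lambda>n. f n + g n) (s + t)"
proof -
  have "summable (\<lambda>n. norm (f n) + norm (g n))"
    using assms by (intro summable_add) (auto simp: abs_sums_def)
  then have "summable (\<lambda>n. norm (f n + g n))"
    by (rule summable_comparison_test'[where N = 0]) (simp add: norm_triangle_ineq)
  then show ?thesis
    using assms sums_add unfolding abs_sums_def by blast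
qed

lemma abs_sums_mult: "abs_sums f s \<Longrightarrow> abs_sums (\<lambda>n. c * f n) (c * s)"
  unfolding abs_sums_def by (auto intro: sums_mult simp: norm_mult summable_mult)

lemma abs_sums_diff: "abs_sums f s \<Longrightarrow> abs_sums g t \<Longrightarrow> abs_sums (\<lambda>n. f n - g n) (s - t)"
  using abs_sums_add[of f s "\<lambda>n. -1 * g n" "-1 * t"] abs_sums_mult[of g t "-1"] by simp

lemma abs_sums_sum:
  "(\<And>i. i \<in> I \<Longrightarrow> abs_sums (f i) (s i)) \<Longrightarrow> abs_sums (\<lambda>n. \<Sum>i\<in>I. f i n) (\<Sum>i\<in>I. s i)"
proof (induction I rule: infinite_finite_induct)
  case (insert i I)
  then show ?case by (simp add: abs_sums_add)
qed (auto simp: abs_sums_def)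

text \<open>Since 4 is twice the support radius, the geometric expansion of the kernel is dominated
  by \<open>(1/2) ^ n\<close> and may be integrated term by term.\<close>

lemma resolvent_abs_sums:
  fixes p :: "real measure"
  assumes "finite_measure p" and [measurable_cong]: "sets p = sets borel"
    and AE: "AE x in p. \<bar>x\<bar> < 2" and z: "4 < cmod z"
  shows "abs_sums (\<lambda>n. (\<integral>x. complex_of_real (x ^ n) \<partial>p) / z ^ Suc n) (\<integral>x. 1 / (z - of_real x) \<partial>p)"
proof -
  interpret finite_measure p by fact
  let ?f = "\<lambda>n x. complex_of_real (x ^ n) / z ^ Suc n"
  have z0: "z \<noteq> 0" using z by auto
  have bound: "AE x in p. cmod (?f n x) \<le> (1/2) ^ n" for n
    using AE
  proof eventually_elim
    case (elim x)
    have "\<bar>x\<bar> / cmod z \<le> 2 / 4"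
      using elim z by (intro frac_le) auto
    then have "(\<bar>x\<bar> / cmod z) ^ n \<le> (1/2) ^ n"
      by (intro power_mono) auto
    then have "(\<bar>x\<bar> / cmod z) ^ n / cmod z \<le> (1/2) ^ n / 1"
      using z by (intro frac_le) auto
    then show ?case
      by (simp add: norm_divide norm_mult norm_power power_divide mult.commute)
  qed
  have int: "integrable p (?f n)" for n
    by (rule integrable_const_bound[OF bound]) measurable
  have nb: "(\<integral>x. cmod (?f n x) \<partial>p) \<le> (1/2) ^ n * measure p UNIV" for n
  proof -
    have "(\<integral>x. cmod (?f n x) \<partial>p) \<le> (\<integral>x. (1/2) ^ n \<partial>p)"
      by (rule integral_mono_AE[OF integrable_norm[OF int] _ bound]) auto
    also have "\<dots> = (1/2) ^ n * measure p UNIV"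
      using sets_eq_imp_space_eq[OF assms(2)] by simp
    finally show ?thesis .
  qed
  have summ: "summable (\<lambda>n. \<integral>x. cmod (?f n x) \<partial>p)"
    by (rule summable_comparison_test'[of "\<lambda>n. (1/2) ^ n * measure p UNIV"])
      (use nb in \<open>auto intro!: summable_mult2 summable_geometric\<close>)
  have geo: "AE x in p. summable (\<lambda>n. cmod (?f n x)) \<and> (\<Sum>n. ?f n x) = 1 / (z - of_real x)"
    using AE
  proof eventually_elim
    case (elim x)
    let ?q = "of_real x / z"
    have q: "cmod ?q < 1"
      using elim z by (simp add: norm_divide divide_less_eq)
    have eq: "?f n x = ?q ^ n * (1 / z)" for n
      by (simp add: power_divide)
    have "(\<lambda>n. ?q ^ n * (1 / z)) sums (1 / (1 - ?q) * (1 / z))"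
      by (intro sums_mult2 geometric_sums q)
    moreover have "1 / (1 - ?q) * (1 / z) = 1 / (z - of_real x)"
      using z0 by (simp add: field_simps)
    moreover have "summable (\<lambda>n. cmod (?q ^ n * (1 / z)))"
      using q by (simp only: norm_mult norm_power) (intro summable_mult2 summable_geometric, simp)
    ultimately show ?case
      by (simp only: eq sums_iff)
  qed
  have s: "(\<lambda>n. \<integral>x. ?f n x \<partial>p) sums (\<integral>x. (\<Sum>n. ?f n x) \<partial>p)"
    by (rule sums_integral[OF int _ summ]) (use geo in auto)
  have "(\<integral>x. (\<Sum>n. ?f n x) \<partial>p) = (\<integral>x. 1 / (z - of_real x) \<partial>p)"
    using geo by (intro integral_cong_AE) auto
  moreover have "summable (\<lambda>n. cmod (\<integral>x. ?f n x \<partial>p))"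
    by (rule summable_comparison_test'[OF summ, of 0]) (simp only: real_norm_def abs_norm_cancel integral_norm_bound)
  ultimately show ?thesis
    using s unfolding abs_sums_def by simp
qed

text \<open>The exact error of the difference quotient of the inverse; its factor
  \<open>a - b\<close> drives the limit in \<open>resolvent_holomorphic\<close>.\<close>

lemma difference_quotient_inverse:
  fixes a b :: complex
  assumes "a \<noteq> 0" "b \<noteq> 0" "a - b \<noteq> 0"
  shows "(1 / a - 1 / b) / (a - b) - (- 1 / b\<^sup>2) = (a - b) / (a * b\<^sup>2)"
proof -
  have cancel: "- c / (a * b) / c = - 1 / (a * b)" if "c \<noteq> 0" for c :: complex
    using that by simp
  have "1 / a - 1 / b = - (a - b) / (a * b)"
    using assms by (simp add: diff_frac_eq)
  then have "(1 / a - 1 / b) / (a - b) = - 1 / (a * b)"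
    using cancel[OF assms(3)] by metis
  also have "\<dots> - (- 1 / b\<^sup>2) = (a - b) / (a * b\<^sup>2)"
    using assms by (simp add: power2_eq_square divide_simps)
  finally show ?thesis .
qed

text \<open>Off the real line the kernel is bounded, hence integrable for a finite measure. The
  error of the difference quotient is bounded linearly in \<open>cmod (w - z)\<close>.\<close>

lemma resolvent_holomorphic:
  fixes p :: "real measure"
  assumes "finite_measure p" and [measurable_cong]: "sets p = sets borel"
  shows "(\<lambda>z. \<integral>x. 1 / (z - of_real x) \<partial>p) holomorphic_on (- \<real>)"
proof -
  interpret finite_measure p by fact
  have ge: "\<bar>Im w\<bar> \<le> cmod (w - of_real x)" for w :: complex and x
    using abs_Im_le_cmod[of "w - of_real x"] by simp
  have nz: "w - of_real x \<noteq> 0" if "w \<notin> \<real>" for w :: complex and x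
    using that by auto
  have int: "integrable p (\<lambda>x. 1 / (w - of_real x))" if "w \<notin> \<real>" for w :: complex
  proof (rule integrable_const_bound[where B="1 / \<bar>Im w\<bar>"])
    show "AE x in p. cmod (1 / (w - of_real x)) \<le> 1 / \<bar>Im w\<bar>"
      using that ge[of w] by (auto simp: norm_divide complex_is_Real_iff intro!: frac_le AE_I2)
  qed measurable
  have "((\<lambda>z. \<integral>x. 1 / (z - of_real x) \<partial>p) has_field_derivative (\<integral>x. - 1 / (z - of_real x)\<^sup>2 \<partial>p)) (at z)"
    if z: "z \<notin> \<real>" for z :: complex
  proof -
    \<comment> \<open>Half the distance to the real line: every \<open>w\<close> within
      \<open>e\<close> of \<open>z\<close> keeps distance at least \<open>e\<close> from all real
      \<open>x\<close>.\<close>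
    define e where "e = \<bar>Im z\<bar> / 2"
    have e: "0 < e" using z by (auto simp: e_def complex_is_Real_iff)
    have near: "w \<notin> \<real> \<and> e \<le> cmod (w - of_real x)" if "dist w z < e" for w x
    proof -
      have "\<bar>Im (w - z)\<bar> < e"
        using that abs_Im_le_cmod[of "w - z"] by (simp add: dist_norm)
      then have "e < \<bar>Im w\<bar>"
        unfolding e_def minus_complex.simps by linarith
      moreover from this have "Im w \<noteq> 0" using e by linarith
      ultimately show ?thesis using ge[of w x] by (simp add: complex_is_Real_iff)
    qed
    have nearz: "e \<le> cmod (z - of_real x)" for x
      using near[of z] e by simp
    have int2: "integrable p (\<lambda>x. - 1 / (z - of_real x)\<^sup>2)"
    proof (rule integrable_const_bound[where B="1 / e\<^sup>2"])
      show "AE x in p. cmod (- 1 / (z - of_real x)\<^sup>2) \<le> 1 / e\<^sup>2"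
      proof (rule AE_I2)
        show "cmod (- 1 / (z - of_real x)\<^sup>2) \<le> 1 / e\<^sup>2" for x
          using power_mono[OF nearz, of 2 x] e frac_le[of 1 1 "e\<^sup>2"] by (simp add: norm_divide norm_power)
      qed
    qed measurable
    let ?F = "\<lambda>z. \<integral>x. 1 / (z - of_real x) \<partial>p"
    let ?D = "\<integral>x. - 1 / (z - of_real x)\<^sup>2 \<partial>p"
    have bd: "cmod ((?F w - ?F z) / (w - z) - ?D) \<le> measure p UNIV / e ^ 3 * cmod (w - z)"
      if w: "w \<noteq> z" "dist w z < e" for w
    proof -
      have pt: "(1 / (w - of_real x) - 1 / (z - of_real x)) / (w - z) - (- 1 / (z - of_real x)\<^sup>2)
          = (w - z) / ((w - of_real x) * (z - of_real x)\<^sup>2)" for x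
        using difference_quotient_inverse[of "w - of_real x" "z - of_real x"] near[OF w(2)] nz z w(1) by simp
      have iw: "integrable p (\<lambda>x. 1 / (w - of_real x))"
        using int near[OF w(2)] by blast
      have "(?F w - ?F z) / (w - z) - ?D =
          (\<integral>x. (1 / (w - of_real x) - 1 / (z - of_real x)) / (w - z) - (- 1 / (z - of_real x)\<^sup>2) \<partial>p)"
        by (simp only: Bochner_Integration.integral_diff[OF iw int[OF z]] integral_divide_zero
            Bochner_Integration.integral_diff[OF integrable_divide_zero[OF Bochner_Integration.integrable_diff[OF iw int[OF z]]] int2])
      also have "\<dots> = (\<integral>x. (w - z) / ((w - of_real x) * (z - of_real x)\<^sup>2) \<partial>p)"
        by (simp only: pt)
      also have "cmod \<dots> \<le> (\<integral>x. cmod (w - z) / e ^ 3 \<partial>p)"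
      proof (rule order_trans[OF integral_norm_bound integral_mono])
        show b3: "cmod ((w - z) / ((w - of_real x) * (z - of_real x)\<^sup>2)) \<le> cmod (w - z) / e ^ 3" for x
        proof -
          have "e * e\<^sup>2 \<le> cmod (w - of_real x) * (cmod (z - of_real x))\<^sup>2"
            using near[OF w(2)] nearz e by (intro mult_mono power_mono) auto
          then have "e ^ 3 \<le> cmod ((w - of_real x) * (z - of_real x)\<^sup>2)"
            by (simp add: norm_mult norm_power power3_eq_cube power2_eq_square mult.assoc)
          then show ?thesis
            unfolding norm_divide using e by (intro frac_le) auto
        qed
        show "integrable p (\<lambda>x. cmod ((w - z) / ((w - of_real x) * (z - of_real x)\<^sup>2)))"
          by (rule integrable_norm[OF integrable_const_bound[OF AE_I2[OF b3]]]) measurable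
      qed auto
      also have "\<dots> = measure p UNIV / e ^ 3 * cmod (w - z)"
        using sets_eq_imp_space_eq[OF assms(2)] by simp
      finally show ?thesis .
    qed
    have "((\<lambda>w. (?F w - ?F z) / (w - z) - ?D) \<longlongrightarrow> 0) (at z)"
    proof (rule Lim_null_comparison)
      show "\<forall>\<^sub>F w in at z. cmod ((?F w - ?F z) / (w - z) - ?D) \<le> measure p UNIV / e ^ 3 * cmod (w - z)"
        using bd e by (auto simp: eventually_at)
      show "((\<lambda>w. measure p UNIV / e ^ 3 * cmod (w - z)) \<longlongrightarrow> 0) (at z)"
        by (intro tendsto_mult_right_zero tendsto_norm_zero LIM_zero tendsto_ident_at)
    qed
    then show ?thesis
      unfolding has_field_derivative_iff by (rule LIM_zero_cancel)
  qed
  then show ?thesis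
    unfolding holomorphic_on_def field_differentiable_def
    by (auto intro: has_field_derivative_at_within)
qed

lemma supported_abs_sums:
  assumes "supported_in_2 \<mu>" "4 < cmod z"
  shows "abs_sums (\<lambda>n. cm_integral \<mu> (\<lambda>x. of_real (x ^ n)) / z ^ Suc n)
    (cm_integral \<mu> (\<lambda>x. 1 / (z - of_real x)))"
proof -
  have *: "abs_sums (\<lambda>n. (\<integral>x. complex_of_real (x ^ n) \<partial>p) / z ^ Suc n) (\<integral>x. 1 / (z - of_real x) \<partial>p)"
    if "p \<in> jordan_parts \<mu>" for p
    using assms that by (intro resolvent_abs_sums jordan_parts_borel(1)) (auto simp: supported_in_2_def)
  show ?thesis
    unfolding cm_integral_def diff_divide_distrib add_divide_distrib times_divide_eq_right[symmetric]
    by (intro abs_sums_add abs_sums_diff abs_sums_mult *) (auto simp: jordan_parts_def)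
qed

lemma supported_holomorphic:
  assumes "supported_in_2 \<mu>"
  shows "(\<lambda>z. cm_integral \<mu> (\<lambda>x. 1 / (z - of_real x))) holomorphic_on (- \<real>)"
proof -
  have *: "(\<lambda>z. \<integral>x. 1 / (z - of_real x) \<partial>p) holomorphic_on (- \<real>)"
    if "p \<in> jordan_parts \<mu>" for p
    using assms that by (intro resolvent_holomorphic jordan_parts_borel(1)) (auto simp: supported_in_2_def)
  show ?thesis
    unfolding cm_integral_def
    by (intro holomorphic_intros *) (auto simp: jordan_parts_def)
qed

section \<open>Matrix-valued series and functions\<close>

lemma matrix_mult_entry: "(A ** B) $ a $ b = (\<Sum>c\<in>UNIV. A $ a $ c * B $ c $ b)"
  by (simp add: matrix_matrix_mult_def)

definition mat_abs_sums :: "(nat \<Rightarrow> complex^'a^'b) \<Rightarrow> complex^'a^'b \<Rightarrow> bool" where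
  "mat_abs_sums F S \<longleftrightarrow> (\<forall>a b. abs_sums (\<lambda>n. F n $ a $ b) (S $ a $ b))"

definition mat_holomorphic :: "(complex \<Rightarrow> complex^'a^'b) \<Rightarrow> bool" where
  "mat_holomorphic F \<longleftrightarrow> (\<forall>a b. (\<lambda>z. F z $ a $ b) holomorphic_on (- \<real>))"

lemma mat_holomorphic_mult:
  "mat_holomorphic F \<Longrightarrow> mat_holomorphic G \<Longrightarrow> mat_holomorphic (\<lambda>z. F z ** G z)"
  unfolding mat_holomorphic_def matrix_mult_entry by (intro allI holomorphic_intros) auto

lemma mat_holomorphic_add:
  "mat_holomorphic F \<Longrightarrow> mat_holomorphic G \<Longrightarrow> mat_holomorphic (\<lambda>z. F z + G z)"
  unfolding mat_holomorphic_def by (auto intro!: holomorphic_intros)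

lemma mat_holomorphic_const: "mat_holomorphic (\<lambda>z. M)"
  unfolding mat_holomorphic_def by auto

text \<open>The complement of the real line is disconnected, so the identity is continued in each
  open half-plane separately.\<close>

lemma mat_holomorphic_eqI:
  assumes F: "mat_holomorphic F" and G: "mat_holomorphic G"
    and eq: "\<And>z. z \<notin> \<real> \<Longrightarrow> r < cmod z \<Longrightarrow> F z = G z" and z: "z \<notin> \<real>"
  shows "F z = G z"
proof -
  have "F z $ a $ b = G z $ a $ b" for a b
  proof -
    have *: "F z $ a $ b = G z $ a $ b"
      if U: "open U" "convex U" "U \<subseteq> - \<real>" "z \<in> U" and v: "v \<in> U" "r < cmod v" for U v
    proof (rule analytic_continuation_open[where
          f = "\<lambda>z. F z $ a $ b" and g = "\<lambda>z. G z $ a $ b" and s = "U \<inter> {w. r < cmod w}" and s' = U])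
      show "open (U \<inter> {w. r < cmod w})"
        by (rule open_Int[OF U(1) open_Collect_less]) (intro continuous_intros)+
      show "(\<lambda>z. F z $ a $ b) holomorphic_on U" "(\<lambda>z. G z $ a $ b) holomorphic_on U"
        using F G U holomorphic_on_subset unfolding mat_holomorphic_def by blast+
    qed (use U v eq convex_connected in auto)
    \<comment> \<open>Since \<open>t\<close> exceeds \<open>r\<close>, the points
      \<open>\<i> * t\<close> and \<open>- \<i> * t\<close> provide a point of agreement in each
      half-plane.\<close>
    define t where "t = \<bar>r\<bar> + 1"
    show ?thesis
    proof (cases "0 < Im z")
      case True
      show ?thesis
        by (rule *[of "{w. 0 < Im w}" "\<i> * of_real t"])
          (use True in \<open>auto simp: open_halfspace_Im_gt convex_halfspace_Im_gt complex_is_Real_iff norm_mult t_def\<close>)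
    next
      case False
      then have "Im z < 0"
        using z by (simp add: complex_is_Real_iff)
      then show ?thesis
        by (intro *[of "{w. Im w < 0}" "- \<i> * of_real t"])
          (auto simp: open_halfspace_Im_lt convex_halfspace_Im_lt complex_is_Real_iff norm_mult t_def)
    qed
  qed
  then show ?thesis by (simp add: vec_eq_iff)
qed

lemma mat_abs_sums_mult_left: "mat_abs_sums F S \<Longrightarrow> mat_abs_sums (\<lambda>n. M ** F n) (M ** S)"
  unfolding mat_abs_sums_def matrix_mult_entry by (auto intro!: abs_sums_sum abs_sums_mult)

lemma mat_sums_Cauchy_product:
  assumes "mat_abs_sums F S" "mat_abs_sums G T"
  shows "(\<lambda>n. (\<Sum>k\<le>n. F k ** G (n - k)) $ a $ b) sums (S ** T) $ a $ b"
proof -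
  have "(\<lambda>n. \<Sum>k\<le>n. F k $ a $ c * G (n - k) $ c $ b) sums (S $ a $ c * T $ c $ b)" for c
    using Cauchy_product_sums[of "\<lambda>n. F n $ a $ c" "\<lambda>n. G n $ c $ b"] assms
    unfolding mat_abs_sums_def abs_sums_def by (simp add: sums_iff)
  then have "(\<lambda>n. \<Sum>c\<in>UNIV. \<Sum>k\<le>n. F k $ a $ c * G (n - k) $ c $ b) sums (S ** T) $ a $ b"
    unfolding matrix_mult_entry by (intro sums_sum)
  then show ?thesis
    by (subst (asm) sum.swap) (simp add: matrix_mult_entry)
qed

section \<open>Block matrix powers\<close>

lemma matrix_sum_left: "(\<Sum>i\<in>I. F i) ** M = (\<Sum>i\<in>I. F i ** (M :: complex^'a^'b))"
  by (simp add: vec_eq_iff matrix_mult_entry sum_distrib_right) (auto intro: sum.swap)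

lemma matrix_sum_right: "M ** (\<Sum>i\<in>I. F i) = (\<Sum>i\<in>I. M ** (F i :: complex^'a^'b))"
  by (induction I rule: infinite_finite_induct) (auto simp: matrix_add_ldistrib)

lemma scaleR_matrix_mult: "(x *\<^sub>R M) ** (L :: complex^'a^'b) = x *\<^sub>R (M ** L)"
  by (simp add: vec_eq_iff matrix_mult_entry scaleR_sum_right)

lemma block_tridiagonal_eq_0:
  "j \<notin> {k - 1..k + 1} \<Longrightarrow> block_tridiagonal A B C j k = 0"
  by (auto simp: block_tridiagonal_def)

lemma infsum_eq_finite_sum:
  fixes f :: "'a \<Rightarrow> 'b::{comm_monoid_add, t2_space}"
  assumes "finite S" "S \<subseteq> V" "\<And>k. k \<in> V - S \<Longrightarrow> f k = 0"
  shows "infsum f V = sum f S"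
proof -
  have "infsum f V = infsum f S"
    by (rule infsum_cong_neutral) (use assms in auto)
  then show ?thesis using assms(1) by simp
qed

lemma block_power_Suc_finite:
  assumes "finite S" "S \<subseteq> V" "\<And>k. k \<in> V - S \<Longrightarrow> \<Phi> j k ** block_power V \<Phi> n k i = 0"
  shows "block_power V \<Phi> (Suc n) j i = (\<Sum>k\<in>S. \<Phi> j k ** block_power V \<Phi> n k i)"
  using infsum_eq_finite_sum[OF assms(1,2), of "\<lambda>k. \<Phi> j k ** block_power V \<Phi> n k i"] assms(3) by simp

lemma block_power_Suc_row:
  "block_power V (block_tridiagonal A B C) (Suc n) j i =
     (\<Sum>k\<in>V \<inter> {j - 1..j + 1}. block_tridiagonal A B C j k ** block_power V (block_tridiagonal A B C) n k i)"
  by (rule block_power_Suc_finite) (auto simp: block_tridiagonal_eq_0)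

text \<open>A path of \<open>n\<close> steps gets at most \<open>n\<close> vertices away; this makes
  the sums over infinite vertex sets finite.\<close>

lemma block_power_eq_0:
  "k \<notin> {i - int n..i + int n} \<Longrightarrow> block_power V (block_tridiagonal A B C) n k i = 0"
proof (induction n arbitrary: k)
  case (Suc n)
  show ?case
    unfolding block_power_Suc_row
  proof (rule sum.neutral, rule ballI)
    fix l assume "l \<in> V \<inter> {k - 1..k + 1}"
    then have "l \<notin> {i - int n..i + int n}" using Suc.prems by auto
    then show "block_tridiagonal A B C k l ** block_power V (block_tridiagonal A B C) n l i = 0"
      by (simp add: Suc.IH)
  qed
qed auto

text \<open>The range depends on the starting vertex \<open>i\<close> but not on \<open>j\<close>,
  so that sums over \<open>j\<close> and \<open>k\<close> can be exchanged.\<close>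

lemma block_power_Suc_column:
  "block_power V (block_tridiagonal A B C) (Suc n) j i =
     (\<Sum>k\<in>V \<inter> {i - int n..i + int n}.
        block_tridiagonal A B C j k ** block_power V (block_tridiagonal A B C) n k i)"
proof (rule block_power_Suc_finite)
  fix k assume "k \<in> V - V \<inter> {i - int n..i + int n}"
  then have "block_power V (block_tridiagonal A B C) n k i = 0"
    by (intro block_power_eq_0) auto
  then show "block_tridiagonal A B C j k ** block_power V (block_tridiagonal A B C) n k i = 0"
    by simp
qed auto

text \<open>
  First passage decomposition: a path from \<open>i\<close> stays in \<open>V\<close> or leaves it for the first time through the
  only exit, the edge from \<open>v\<close> to \<open>u\<close>.
\<close>

lemma block_power_exit:
  fixes A B C :: "int \<Rightarrow> ('n::finite) supmat"
  defines "T \<equiv> block_tridiagonal A B C"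
  assumes "v \<in> V" "u \<notin> V" "i \<in> V"
    and exit: "\<And>j k. j \<notin> V \<Longrightarrow> k \<in> V \<Longrightarrow> (j, k) \<noteq> (u, v) \<Longrightarrow> T j k = 0"
  shows "block_power UNIV T n j i = (if j \<in> V then block_power V T n j i else 0)
    + (\<Sum>k<n. block_power UNIV T (n - 1 - k) j u ** T u v ** block_power V T k v i)"
proof (induction n arbitrary: j)
  case 0
  then show ?case using assms(4) by auto
next
  case (Suc n)
  let ?K = "{j - 1..j + 1}"
  have "block_power UNIV T (Suc n) j i = (\<Sum>k\<in>?K. T j k ** block_power UNIV T n k i)"
    unfolding T_def by (subst block_power_Suc_row) simp
  also have "\<dots> = (\<Sum>k\<in>?K. if k \<in> V then T j k ** block_power V T n k i else 0)
      + (\<Sum>k\<in>?K. \<Sum>l<n. T j k ** block_power UNIV T (n - 1 - l) k u ** T u v ** block_power V T l v i)"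
    unfolding sum.distrib[symmetric]
    by (rule sum.cong) (auto simp: Suc.IH matrix_add_ldistrib matrix_sum_right matrix_mul_assoc)
  also have "(\<Sum>k\<in>?K. if k \<in> V then T j k ** block_power V T n k i else 0)
      = (\<Sum>k\<in>V \<inter> ?K. T j k ** block_power V T n k i)"
    by (subst sum.inter_restrict[symmetric]) (auto simp: Int_commute)
  also have "(\<Sum>k\<in>?K. \<Sum>l<n. T j k ** block_power UNIV T (n - 1 - l) k u ** T u v ** block_power V T l v i)
      = (\<Sum>l<n. block_power UNIV T (n - l) j u ** T u v ** block_power V T l v i)"
  proof (subst sum.swap, rule sum.cong)
    fix l assume "l \<in> {..<n}"
    then have l: "n - l = Suc (n - 1 - l)" by auto
    show "(\<Sum>k\<in>?K. T j k ** block_power UNIV T (n - 1 - l) k u ** T u v ** block_power V T l v i)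
        = block_power UNIV T (n - l) j u ** T u v ** block_power V T l v i"
      unfolding l T_def by (subst block_power_Suc_row) (simp add: matrix_sum_left)
  qed simp
  \<comment> \<open>For \<open>j\<close> in \<open>V\<close> this is the restricted recursion; for
    \<open>j\<close> outside, only the exit edge contributes.\<close>
  also have "(\<Sum>k\<in>V \<inter> ?K. T j k ** block_power V T n k i) =
      (if j \<in> V then block_power V T (Suc n) j i else 0)
      + (if j = u then T u v ** block_power V T n v i else 0)"
  proof (cases "j \<in> V")
    case True
    then show ?thesis
      using assms(3) unfolding T_def by (subst block_power_Suc_row) auto
  next
    case False
    then have "(\<Sum>k\<in>V \<inter> ?K. T j k ** block_power V T n k i)
        = (\<Sum>k\<in>V \<inter> ?K. if k = v then (if j = u then T u v ** block_power V T n v i else 0) else 0)"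
      by (intro sum.cong) (auto simp: exit)
    also have "\<dots> = (if v \<in> ?K \<and> j = u then T u v ** block_power V T n v i else 0)"
      using assms(2) by (subst sum.delta) auto
    \<comment> \<open>The condition on \<open>v\<close> may be dropped: if \<open>j = u\<close> and
      \<open>v\<close> is outside \<open>?K\<close>, then \<open>T u v\<close> is 0.\<close>
    also have "\<dots> = (if j = u then T u v ** block_power V T n v i else 0)"
      unfolding T_def by (auto simp: block_tridiagonal_eq_0)
    finally show ?thesis using False by simp
  qed
  \<comment> \<open>The exit term becomes the summand \<open>l = n\<close>, where the full chain has
    exponent 0 and so contributes the identity for \<open>j = u\<close> and 0 otherwise.\<close>
  also have "(if j \<in> V then block_power V T (Suc n) j i else 0)
        + (if j = u then T u v ** block_power V T n v i else 0)
        + (\<Sum>l<n. block_power UNIV T (n - l) j u ** T u v ** block_power V T l v i)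
      = (if j \<in> V then block_power V T (Suc n) j i else 0)
        + (\<Sum>l<Suc n. block_power UNIV T (Suc n - 1 - l) j u ** T u v ** block_power V T l v i)"
    by (simp add: add.commute matrix_mul_assoc)
  finally show ?case .
qed

section \<open>Boundedness of the powers of a quantum Markov chain\<close>

lemma superop_entry:
  "superop M X $ a $ b = (\<Sum>q\<in>UNIV. M $ (a, b) $ q * X $ fst q $ snd q)"
  by (simp add: superop_def unvec_rows_def vec_rows_def matrix_vector_mult_def)

lemma superop_mult: "superop (M ** L) X = superop M (superop L X)"
  by (simp add: superop_def vec_rows_def unvec_rows_def vec_eq_iff matrix_vector_mul_assoc[symmetric])

lemma superop_sum: "superop (\<Sum>i\<in>I. M i) X = (\<Sum>i\<in>I. superop (M i) X)"
  by (simp add: vec_eq_iff superop_entry sum_distrib_right) (auto intro: sum.swap)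

lemma superop_mat_1: "superop (mat 1) X = X"
  by (simp add: superop_def vec_rows_def unvec_rows_def vec_eq_iff)

lemma superop_0: "superop 0 X = 0"
  by (simp add: vec_eq_iff superop_entry)

lemma trace_sum: "trace (\<Sum>i\<in>I. M i) = (\<Sum>i\<in>I. trace (M i :: complex^'a^'a))"
  by (simp add: trace_def) (rule sum.swap)

lemma psd_0: "psd 0"
  by (simp add: psd_def)

lemma psd_add: "psd M \<Longrightarrow> psd L \<Longrightarrow> psd (M + L)"
  unfolding psd_def
  by (simp add: matrix_vector_mult_add_rdistrib algebra_simps sum.distrib nonneg_Reals_add_I)

lemma psd_sum: "(\<And>i. i \<in> I \<Longrightarrow> psd (M i)) \<Longrightarrow> psd (\<Sum>i\<in>I. M i)"
  by (induction I rule: infinite_finite_induct) (auto simp: psd_0 psd_add)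

text \<open>This is the amplification with \<open>k = 1\<close>.\<close>

lemma completely_positive_psd:
  assumes "completely_positive M" "psd X"
  shows "psd (superop M X)"
proof -
  have "block_psd 1 (\<lambda>a b. X) \<longrightarrow> block_psd 1 (\<lambda>a b. superop M X)"
    using assms(1) unfolding completely_positive_def by (drule_tac spec[of _ 1]) blast
  then have "(\<forall>v :: nat \<Rightarrow> complex^'a. (\<Sum>i\<in>UNIV. cnj (v 0 $ i) * (superop M X *v v 0) $ i) \<in> \<real>\<^sub>\<ge>\<^sub>0)"
    using assms(2) by (simp add: block_psd_def psd_def)
  then show ?thesis
    unfolding psd_def by (intro allI) (drule_tac x="\<lambda>_. v" in spec, simp)
qed

text \<open>Every row contributes a nonnegative trace, so a finite part of the column is bounded by
  the whole column, which preserves the trace. Restricting the chain can therefore only lose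
  trace.\<close>

lemma column_trace_le:
  fixes A B C :: "int \<Rightarrow> ('n::finite) supmat"
  assumes Q: "quantum_markov_chain UNIV (block_tridiagonal A B C)" and X: "psd X" and S: "finite S"
  shows "(\<Sum>j\<in>S. Re (trace (superop (block_tridiagonal A B C j k) X))) \<le> Re (trace X)"
proof -
  let ?T = "block_tridiagonal A B C" and ?K = "{k - 1..k + 1}"
  obtain L where L: "((\<lambda>j. ?T j k) has_sum L) UNIV" "trace_preserving L"
    using Q unfolding quantum_markov_chain_def by blast
  have "infsum (\<lambda>j. ?T j k) UNIV = (\<Sum>j\<in>?K. ?T j k)"
    by (rule infsum_eq_finite_sum) (auto simp: block_tridiagonal_eq_0)
  then have L_eq: "L = (\<Sum>j\<in>?K. ?T j k)"
    using infsumI[OF L(1)] by simp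
  have nn: "0 \<le> Re (trace (superop (?T j k) X))" for j
    using Q X by (intro psd_trace(2) completely_positive_psd) (auto simp: quantum_markov_chain_def)
  have "(\<Sum>j\<in>S. Re (trace (superop (?T j k) X))) = (\<Sum>j\<in>S \<inter> ?K. Re (trace (superop (?T j k) X)))"
    using S by (intro sum.mono_neutral_right) (auto simp: block_tridiagonal_eq_0 superop_0 trace_def)
  also have "\<dots> \<le> (\<Sum>j\<in>?K. Re (trace (superop (?T j k) X)))"
    by (intro sum_mono2) (auto simp: nn)
  also have "\<dots> = Re (trace (superop L X))"
    by (simp only: L_eq superop_sum trace_sum Re_sum)
  also have "\<dots> = Re (trace X)"
    using L(2) by (simp add: trace_preserving_def)
  finally show ?thesis .
qed

text \<open>Conservation of probability, as an inequality. The induction runs on the total over all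
  reachable vertices, because the trace at a single vertex satisfies no recursion of its
  own.\<close>

lemma block_power_psd_trace:
  fixes A B C :: "int \<Rightarrow> ('n::finite) supmat"
  assumes Q: "quantum_markov_chain UNIV (block_tridiagonal A B C)" and X: "psd X" and i: "i \<in> V"
  defines "D \<equiv> block_power V (block_tridiagonal A B C)"
  shows "psd (superop (D n j i) X)"
    and "(\<Sum>j\<in>V \<inter> {i - int n..i + int n}. Re (trace (superop (D n j i) X))) \<le> Re (trace X)"
proof -
  let ?T = "block_tridiagonal A B C"
  have cp: "psd (superop (?T j k) Y)" if "psd Y" for j k Y
    using Q that by (intro completely_positive_psd) (auto simp: quantum_markov_chain_def)
  have psd: "psd (superop (D n j i) X)" for n j
  proof (induction n arbitrary: j)
    case 0
    show ?case using X by (auto simp: D_def superop_mat_1 superop_0 psd_0)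
  next
    case (Suc n)
    show ?case
      unfolding D_def block_power_Suc_column superop_sum superop_mult
      by (intro psd_sum cp Suc.IH[unfolded D_def])
  qed
  then show "psd (superop (D n j i) X)" .
  show "(\<Sum>j\<in>V \<inter> {i - int n..i + int n}. Re (trace (superop (D n j i) X))) \<le> Re (trace X)"
  proof (induction n)
    case 0
    have "V \<inter> {i - int 0..i + int 0} = {i}" using i by auto
    then show ?case by (simp add: D_def superop_mat_1)
  next
    case (Suc n)
    let ?S = "V \<inter> {i - int n..i + int n}" and ?S' = "V \<inter> {i - int (Suc n)..i + int (Suc n)}"
    have "(\<Sum>j\<in>?S'. Re (trace (superop (D (Suc n) j i) X)))
        = (\<Sum>j\<in>?S'. \<Sum>k\<in>?S. Re (trace (superop (?T j k) (superop (D n k i) X))))"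
      unfolding D_def block_power_Suc_column superop_sum superop_mult trace_sum Re_sum ..
    also have "\<dots> = (\<Sum>k\<in>?S. \<Sum>j\<in>?S'. Re (trace (superop (?T j k) (superop (D n k i) X))))"
      by (rule sum.swap)
    also have "\<dots> \<le> (\<Sum>k\<in>?S. Re (trace (superop (D n k i) X)))"
      by (intro sum_mono column_trace_le Q psd) auto
    also have "\<dots> \<le> Re (trace X)" by (rule Suc.IH)
    finally show ?case .
  qed
qed

text \<open>Polarisation writes a matrix unit as a quarter of a combination of four rank-one inputs.
  Each has trace at most 4, so each output entry has modulus at most twice that by
  \<open>psd_entry_bound\<close>, and the average of the four keeps the bound 8.\<close>

lemma positive_trace_bounded_entry:
  fixes M :: "('n::finite) supmat"
  assumes psd: "\<And>X. psd X \<Longrightarrow> psd (superop M X)"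
    and tr: "\<And>X. psd X \<Longrightarrow> Re (trace (superop M X)) \<le> Re (trace X)"
  shows "cmod (M $ p $ q) \<le> 8"
proof -
  obtain a b where p: "p = (a, b)" by (cases p)
  obtain r s where q: "q = (r, s)" by (cases q)
  define x where "x c = (\<chi> t. (if t = r then 1 else 0) + (if t = s then c else 0))" for c :: complex
  define X where "X c = (\<chi> i j. x c $ i * cnj (x c $ j))" for c
  have psdX: "psd (X c)" for c
    unfolding X_def by (rule psd_rank_one)
  have "trace (X c) = (if r = s then (1 + c) * cnj (1 + c) else 1 + c * cnj c)" for c
  proof -
    have "trace (X c) = (\<Sum>t\<in>UNIV. (if t = r then cnj (x c $ t) else 0) + (if t = s then c * cnj (x c $ t) else 0))"
      unfolding trace_def X_def by (intro sum.cong) (auto simp: x_def algebra_simps)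
    also have "\<dots> = cnj (x c $ r) + c * cnj (x c $ s)"
      by (simp add: sum.distrib)
    finally show ?thesis by (auto simp: x_def algebra_simps)
  qed
  \<comment> \<open>The value 4 occurs for \<open>r = s\<close> and \<open>c = 1\<close>; for
    distinct indices the trace is 2.\<close>
  then have trX: "Re (trace (X c)) \<le> 4" if "c \<in> {1, -1, \<i>, -\<i>}" for c
    using that by auto
  have bound: "cmod (superop M (X c) $ a $ b) \<le> 8" if "c \<in> {1, -1, \<i>, -\<i>}" for c
    using psd_entry_bound[OF psd[OF psdX], of c a b] psd_trace(1)[OF psd[OF psdX], of c a]
      psd_trace(1)[OF psd[OF psdX], of c b] tr[OF psdX, of c] trX[OF that] by linarith
  have pol: "X 1 $ i $ j - X (-1) $ i $ j + \<i> * X \<i> $ i $ j - \<i> * X (-\<i>) $ i $ j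
      = (if i = r \<and> j = s then 4 else 0)" for i j
    by (auto simp: X_def x_def algebra_simps)
  have "4 * M $ p $ q = (\<Sum>t\<in>UNIV. M $ (a, b) $ t * (if fst t = r \<and> snd t = s then 4 else 0))"
  proof -
    have "(\<Sum>t\<in>UNIV. M $ (a, b) $ t * (if fst t = r \<and> snd t = s then 4 else 0))
        = (\<Sum>t\<in>UNIV. if t = (r, s) then M $ (a, b) $ t * 4 else 0)"
      by (intro sum.cong) auto
    then show ?thesis by (simp add: p q)
  qed
  also have "\<dots> = superop M (X 1) $ a $ b - superop M (X (-1)) $ a $ b
      + \<i> * superop M (X \<i>) $ a $ b - \<i> * superop M (X (-\<i>)) $ a $ b"
    unfolding superop_entry pol[symmetric]
    by (simp add: algebra_simps sum.distrib sum_subtractf sum_distrib_left)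
  finally have eq: "4 * M $ p $ q = superop M (X 1) $ a $ b - superop M (X (-1)) $ a $ b
      + \<i> * superop M (X \<i>) $ a $ b - \<i> * superop M (X (-\<i>)) $ a $ b" .
  have norm4: "cmod (x - y + u - v) \<le> cmod x + cmod y + cmod u + cmod v" for x y u v :: complex
    using norm_triangle_ineq4[of "x - y + u" v] norm_triangle_ineq[of "x - y" u] norm_triangle_ineq4[of x y]
    by linarith
  have "cmod (4 * M $ p $ q) \<le> cmod (superop M (X 1) $ a $ b) + cmod (superop M (X (-1)) $ a $ b)
      + cmod (\<i> * superop M (X \<i>) $ a $ b) + cmod (\<i> * superop M (X (-\<i>)) $ a $ b)"
    unfolding eq by (rule norm4)
  also have "\<dots> \<le> 8 + 8 + 8 + 8"
    unfolding norm_mult norm_ii mult_1 by (intro add_mono bound) auto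
  finally show ?thesis by (simp add: norm_mult)
qed

lemma block_power_bounded:
  fixes A B C :: "int \<Rightarrow> ('n::finite) supmat"
  assumes Q: "quantum_markov_chain UNIV (block_tridiagonal A B C)" and "i \<in> V" "j \<in> V"
  shows "cmod (block_power V (block_tridiagonal A B C) n j i $ p $ q) \<le> 8"
proof (rule positive_trace_bounded_entry)
  fix X :: "complex^'n^'n" assume X: "psd X"
  let ?D = "block_power V (block_tridiagonal A B C) n"
  note * = block_power_psd_trace[OF Q X \<open>i \<in> V\<close>]
  show "psd (superop (?D j i) X)" by (rule *)
  show "Re (trace (superop (?D j i) X)) \<le> Re (trace X)"
  proof (cases "j \<in> {i - int n..i + int n}")
    case True
    then have "Re (trace (superop (?D j i) X)) \<le> (\<Sum>j\<in>V \<inter> {i - int n..i + int n}. Re (trace (superop (?D j i) X)))"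
      using \<open>j \<in> V\<close> by (intro member_le_sum) (auto intro: psd_trace(2) *(1))
    also have "\<dots> \<le> Re (trace X)" by (rule *)
    finally show ?thesis .
  next
    case False
    then show ?thesis
      using psd_trace(2)[OF X] by (simp add: block_power_eq_0 superop_0 trace_def)
  qed
qed

section \<open>Matrix algebra\<close>

lemma matrix_mul_rzero: "M ** 0 = (0 :: complex^'a^'b)"
  by (simp add: vec_eq_iff matrix_mult_entry)

lemma matrix_inv_inverse:
  assumes "invertible (M :: complex^'a^'a)"
  shows matrix_inv_right: "M ** matrix_inv M = mat 1" and matrix_inv_left: "matrix_inv M ** M = mat 1"
  using someI_ex[OF assms[unfolded invertible_def]] by (auto simp: matrix_inv_def)

lemma matrix_add_rdistrib: "(X + Y) ** M = X ** M + Y ** (M :: complex^'a^'b)"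
  by (simp add: vec_eq_iff matrix_mult_entry algebra_simps sum.distrib)

lemma matrix_diff_ldistrib: "M ** (X - Y) = M ** X - M ** (Y :: complex^'a^'b)"
  by (simp add: vec_eq_iff matrix_mult_entry algebra_simps sum_subtractf)

text \<open>The inverse of \<open>1 - a G b\<close> is \<open>1 + a Y b\<close> where \<open>Y = G (1 - b a G)\<inverse>\<close>.\<close>

lemma invertible_if_resolvent:
  fixes a b G Y :: "complex^'m^'m"
  assumes Y: "Y = G + Y ** b ** a ** G"
  shows "invertible (mat 1 - a ** G ** b)"
proof -
  let ?P = "a ** Y ** b" and ?Q = "a ** G ** b"
  have "?P = a ** (G + Y ** b ** a ** G) ** b"
    by (subst Y) (rule refl)
  also have "\<dots> = ?Q + ?P ** ?Q"
    by (simp add: matrix_add_ldistrib matrix_add_rdistrib matrix_mul_assoc)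
  finally have P: "?P = ?Q + ?P ** ?Q" .
  have "(mat 1 + ?P) ** (mat 1 - ?Q) = mat 1 + ?P - (?Q + ?P ** ?Q)"
    unfolding matrix_diff_ldistrib matrix_add_rdistrib by simp
  also have "\<dots> = mat 1"
    unfolding P[symmetric] by simp
  finally show ?thesis
    unfolding invertible_left_inverse by blast
qed

lemma matrix_inv_cancel_right: "invertible M \<Longrightarrow> L ** (M :: complex^'a^'a) ** matrix_inv M = L"
  by (simp add: matrix_mul_assoc[symmetric] matrix_inv_right)

lemma eq_mult_matrix_inv:
  fixes X G M :: "complex^'m^'m"
  assumes "invertible (mat 1 - M)" "X = G + X ** M"
  shows "X = G ** matrix_inv (mat 1 - M)"
proof -
  have "X ** (mat 1 - M) = G"
    unfolding matrix_diff_ldistrib matrix_mul_rid by (subst (1) assms(2)) simp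
  then show ?thesis
    using matrix_inv_cancel_right[OF assms(1)] by metis
qed

section \<open>Moments of the weight matrices\<close>

lemma cm_integrable_poly:
  assumes "weight_matrix W"
  shows "cm_integrable (\<lambda>E. W E $ a $ b) (\<lambda>x. poly p (of_real x))"
proof -
  have "cm_integrable (\<lambda>E. W E $ a $ b) (\<lambda>x. \<Sum>k\<le>degree p. of_real (x ^ k) * coeff p k)"
    using assms by (intro cm_integrable_sum cm_integrable_mult_right) (auto simp: weight_matrix_def)
  then show ?thesis by (simp add: poly_altdef mult.commute)
qed

text \<open>Weight matrices guarantee integrability of polynomials, while the generated families are
  given only by their values; polynomiality has to be recovered from the recurrence.\<close>

definition poly_entries :: "(real \<Rightarrow> complex^'a^'b) \<Rightarrow> bool" where
  "poly_entries F \<longleftrightarrow> (\<forall>a b. \<exists>p. \<forall>x. F x $ a $ b = poly p (of_real x))"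

lemma poly_entries_const: "poly_entries (\<lambda>x. M)"
  unfolding poly_entries_def by (auto intro: exI[of _ "[:c:]" for c])

lemma poly_entries_scaleR: "poly_entries F \<Longrightarrow> poly_entries (\<lambda>x. x *\<^sub>R F x)"
  unfolding poly_entries_def
proof (intro allI)
  fix a b
  assume "\<forall>a b. \<exists>p. \<forall>x. F x $ a $ b = poly p (of_real x)"
  then obtain p where "\<forall>x. F x $ a $ b = poly p (of_real x)" by blast
  then show "\<exists>p. \<forall>x. (x *\<^sub>R F x) $ a $ b = poly p (of_real x)"
    by (intro exI[of _ "pCons 0 p"]) (simp add: scaleR_conv_of_real[where 'a=complex])
qed

lemma poly_entries_diff:
  assumes "poly_entries F" "poly_entries G"
  shows "poly_entries (\<lambda>x. F x - G x)"
  unfolding poly_entries_def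
proof (intro allI)
  fix a b
  obtain p q where "\<forall>x. F x $ a $ b = poly p (of_real x)" "\<forall>x. G x $ a $ b = poly q (of_real x)"
    using assms unfolding poly_entries_def by meson
  then show "\<exists>p. \<forall>x. (F x - G x) $ a $ b = poly p (of_real x)"
    by (intro exI[of _ "p - q"]) simp
qed

lemma poly_entries_mult:
  fixes F :: "real \<Rightarrow> complex^'a^'b" and M :: "complex^'c^'a"
  assumes "poly_entries F"
  shows "poly_entries (\<lambda>x. F x ** M)"
  unfolding poly_entries_def
proof (intro allI)
  fix a b
  obtain p where p: "\<And>c x. F x $ a $ c = poly (p c) (of_real x)"
    using assms unfolding poly_entries_def by metis
  show "\<exists>q. \<forall>x. (F x ** M) $ a $ b = poly q (of_real x)"
    by (intro exI[of _ "\<Sum>c\<in>UNIV. smult (M $ c $ b) (p c)"])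
      (simp add: matrix_mult_entry p poly_sum mult.commute)
qed

text \<open>The recurrence is solved for its newest member \<open>K\<close>. The coefficient
  \<open>M\<close> is an \<open>A n\<close> on the right half-line and a \<open>C n\<close> on the
  left one.\<close>

lemma poly_entries_step:
  fixes F G K :: "real \<Rightarrow> complex^'a^'b" and M B :: "complex^'a^'a"
  assumes "invertible M" "poly_entries F" "poly_entries G"
    and "\<And>x. x *\<^sub>R F x = K x ** M + F x ** B + G x"
  shows "poly_entries K"
proof -
  have "K x = (x *\<^sub>R F x - F x ** B - G x) ** matrix_inv M" for x
    using assms(4)[of x] by (simp add: matrix_inv_cancel_right assms(1))
  then have K: "K = (\<lambda>x. (x *\<^sub>R F x - F x ** B - G x) ** matrix_inv M)"
    by auto
  show ?thesis
    unfolding K by (intro poly_entries_mult poly_entries_diff poly_entries_scaleR assms(2,3))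
qed

text \<open>The range \<open>S\<close> is left free so that rows for different \<open>n\<close> can
  be summed over a common range.\<close>

lemma generated_polys_row:
  assumes "generated_polys V (block_tridiagonal A B C) v P" "n \<in> V" "finite S" "V \<inter> {n - 1..n + 1} \<subseteq> S" "S \<subseteq> V"
  shows "x *\<^sub>R P n x = (\<Sum>m\<in>S. P m x ** block_tridiagonal A B C m n)"
proof -
  have "x *\<^sub>R P n x = (\<Sum>\<^sub>\<infinity>m\<in>V. P m x ** block_tridiagonal A B C m n)"
    using assms(1,2) unfolding generated_polys_def by blast
  also have "\<dots> = (\<Sum>m\<in>S. P m x ** block_tridiagonal A B C m n)"
  proof (rule infsum_eq_finite_sum)
    fix k assume "k \<in> V - S"
    then have "k \<notin> {n - 1..n + 1}" using assms(4) by auto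
    then show "P k x ** block_tridiagonal A B C k n = 0"
      by (simp add: block_tridiagonal_eq_0)
  qed (use assms(3,5) in auto)
  finally show ?thesis .
qed

lemma generated_polys_nonneg_poly:
  fixes A B C :: "int \<Rightarrow> ('n::finite) supmat"
  assumes P: "generated_polys {0..} (block_tridiagonal A B C) 0 P"
    and A: "\<And>n. n \<ge> 0 \<Longrightarrow> invertible (A n)"
  shows "poly_entries (P (int n))"
proof (induction n rule: less_induct)
  case (less n)
  show ?case
  proof (cases n)
    case 0
    have "P 0 = (\<lambda>x. mat 1)" using P by (auto simp: generated_polys_def)
    then show ?thesis using 0 by (simp add: poly_entries_const)
  next
    case (Suc k)
    \<comment> \<open>At the boundary vertex 0 the restricted chain has no neighbour on the left, so
      the backward term is absent.\<close>
    define G where "G = (\<lambda>x. if k = 0 then 0 else P (int k - 1) x ** C (int k))"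
    have G: "poly_entries G"
    proof (cases k)
      case 0
      then show ?thesis by (simp add: G_def poly_entries_const)
    next
      case (Suc l)
      then show ?thesis using less.IH[of l] \<open>n = Suc k\<close> by (simp add: G_def poly_entries_mult)
    qed
    have "x *\<^sub>R P (int k) x = P (int n) x ** A (int k) + P (int k) x ** B (int k) + G x" for x
    proof -
      have "x *\<^sub>R P (int k) x = (\<Sum>m\<in>{0..} \<inter> {int k - 1..int k + 1}. P m x ** block_tridiagonal A B C m (int k))"
        by (rule generated_polys_row[OF P]) auto
      also have "{0..} \<inter> {int k - 1..int k + 1} = (if k = 0 then {} else {int k - 1}) \<union> {int k, int k + 1}"
        by auto
      finally show ?thesis using Suc by (auto simp: block_tridiagonal_def G_def add.commute)
    qed
    then show ?thesis
      by (rule poly_entries_step[OF A[of "int k"] less.IH[of k] G, rotated 2]) (use Suc in auto)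
  qed
qed

lemma generated_polys_neg_poly:
  fixes A B C :: "int \<Rightarrow> ('n::finite) supmat"
  assumes P: "generated_polys {..-1} (block_tridiagonal A B C) (-1) P"
    and C: "\<And>n. n \<le> -1 \<Longrightarrow> invertible (C n)"
  shows "poly_entries (P (- 1 - int n))"
proof (induction n rule: less_induct)
  case (less n)
  show ?case
  proof (cases n)
    case 0
    have "P (-1) = (\<lambda>x. mat 1)" using P by (auto simp: generated_polys_def)
    then show ?thesis using 0 by (simp add: poly_entries_const)
  next
    case (Suc k)
    let ?k = "- 1 - int k"
    \<comment> \<open>Here the boundary vertex is -1, whose right neighbour is cut off.\<close>
    define G where "G = (\<lambda>x. if k = 0 then 0 else P (- int k) x ** A ?k)"
    have G: "poly_entries G"
    proof (cases k)
      case 0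
      then show ?thesis by (simp add: G_def poly_entries_const)
    next
      case (Suc l)
      have "- int k = -1 - int l" using Suc by simp
      then show ?thesis using less.IH[of l] \<open>n = Suc k\<close> Suc by (simp add: G_def poly_entries_mult)
    qed
    have n: "- 1 - int n = - int k - 2" using Suc by simp
    have "x *\<^sub>R P ?k x = P (- 1 - int n) x ** C ?k + P ?k x ** B ?k + G x" for x
    proof -
      have "x *\<^sub>R P ?k x = (\<Sum>m\<in>{..-1} \<inter> {?k - 1..?k + 1}. P m x ** block_tridiagonal A B C m ?k)"
        by (rule generated_polys_row[OF P]) auto
      also have "{..-1} \<inter> {?k - 1..?k + 1} = (if k = 0 then {} else {- int k}) \<union> {?k, - int k - 2}"
        by auto
      finally show ?thesis unfolding n by (auto simp: block_tridiagonal_def G_def)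
    qed
    then show ?thesis
      by (rule poly_entries_step[OF C[of ?k] less.IH[of k] G, rotated 2]) (use Suc in auto)
  qed
qed

text \<open>A left eigenvector for \<open>x\<close> is one for \<open>x ^ n\<close> of the power.
  This expands \<open>x ^ n\<close> times a polynomial in the family itself, with block powers as
  coefficients.\<close>

lemma generated_polys_power:
  fixes A B C :: "int \<Rightarrow> ('n::finite) supmat"
  assumes P: "generated_polys V (block_tridiagonal A B C) v P" and i: "i \<in> V"
  defines "D \<equiv> block_power V (block_tridiagonal A B C)"
  shows "(x ^ n) *\<^sub>R P i x = (\<Sum>m\<in>V \<inter> {i - int n..i + int n}. P m x ** D n m i)"
proof (induction n)
  case 0
  have "V \<inter> {i - int 0..i + int 0} = {i}" using i by auto
  then show ?case by (simp add: D_def)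
next
  case (Suc n)
  let ?T = "block_tridiagonal A B C"
  let ?S = "V \<inter> {i - int n..i + int n}" and ?S' = "V \<inter> {i - int (Suc n)..i + int (Suc n)}"
  have "(\<Sum>m\<in>?S'. P m x ** D (Suc n) m i) = (\<Sum>m\<in>?S'. \<Sum>k\<in>?S. P m x ** ?T m k ** D n k i)"
    unfolding D_def block_power_Suc_column matrix_sum_right matrix_mul_assoc ..
  also have "\<dots> = (\<Sum>k\<in>?S. (\<Sum>m\<in>?S'. P m x ** ?T m k) ** D n k i)"
    unfolding matrix_sum_left by (rule sum.swap)
  also have "\<dots> = (\<Sum>k\<in>?S. (x *\<^sub>R P k x) ** D n k i)"
    by (rule sum.cong[OF refl], subst generated_polys_row[OF P, where S = ?S']) auto
  also have "\<dots> = x *\<^sub>R (\<Sum>k\<in>?S. P k x ** D n k i)"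
    by (simp add: scaleR_matrix_mult scaleR_sum_right)
  also have "\<dots> = (x ^ Suc n) *\<^sub>R P i x"
    by (simp only: Suc.IH[symmetric] scaleR_scaleR power_Suc)
  finally show ?case by simp
qed

section \<open>Moments of the weights as block powers\<close>

lemma sandwich_integral_left_1:
  "sandwich_integral (\<lambda>x. mat 1) W G $ a $ b = (\<Sum>d\<in>UNIV. cm_integral (\<lambda>E. W E $ a $ d) (\<lambda>x. G x $ d $ b))"
proof -
  have "sandwich_integral (\<lambda>x. mat 1) W G $ a $ b =
      (\<Sum>c\<in>UNIV. if c = a then (\<Sum>d\<in>UNIV. cm_integral (\<lambda>E. W E $ c $ d) (\<lambda>x. G x $ d $ b)) else 0)"
    unfolding sandwich_integral_def vec_lambda_beta by (intro sum.cong) (auto simp: mat_def)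
  then show ?thesis by simp
qed

lemma sandwich_integral_scaled_mat_1:
  "sandwich_integral (\<lambda>x. mat 1) W (\<lambda>x. (x ^ n) *\<^sub>R mat 1) = mat_integral W (\<lambda>x. of_real (x ^ n))"
proof -
  have "sandwich_integral (\<lambda>x. mat 1) W (\<lambda>x. (x ^ n) *\<^sub>R mat 1) $ a $ b
      = mat_integral W (\<lambda>x. of_real (x ^ n)) $ a $ b" for a b
  proof -
    have "sandwich_integral (\<lambda>x. mat 1) W (\<lambda>x. (x ^ n) *\<^sub>R mat 1) $ a $ b =
        (\<Sum>d\<in>UNIV. if d = b then cm_integral (\<lambda>E. W E $ a $ d) (\<lambda>x. of_real (x ^ n)) else 0)"
      unfolding sandwich_integral_left_1 by (intro sum.cong) (auto simp: mat_def scaleR_conv_of_real[where 'a=complex])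
    also have "\<dots> = mat_integral W (\<lambda>x. of_real (x ^ n)) $ a $ b"
      by (simp add: mat_integral_def)
    finally show ?thesis .
  qed
  then show ?thesis by (simp add: vec_eq_iff)
qed

lemma sandwich_integral_mat_1_scaled:
  "sandwich_integral (\<lambda>x. (x ^ n) *\<^sub>R mat 1) W (\<lambda>x. mat 1) = mat_integral W (\<lambda>x. of_real (x ^ n))"
proof -
  have "sandwich_integral (\<lambda>x. (x ^ n) *\<^sub>R mat 1) W (\<lambda>x. mat 1) $ a $ b
      = mat_integral W (\<lambda>x. of_real (x ^ n)) $ a $ b" for a b
  proof -
    have "cm_integral (\<lambda>E. W E $ c $ d) (\<lambda>x. ((x ^ n) *\<^sub>R mat 1) $ a $ c * mat 1 $ d $ b)
        = (if d = b then if c = a then cm_integral (\<lambda>E. W E $ c $ d) (\<lambda>x. of_real (x ^ n)) else 0 else 0)" for c d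
      by (auto simp: mat_def scaleR_conv_of_real[where 'a=complex])
    then show ?thesis
      by (simp add: sandwich_integral_def mat_integral_def del: of_real_power vector_scaleR_component)
  qed
  then show ?thesis by (simp add: vec_eq_iff)
qed

lemma sandwich_integral_sum_mult:
  assumes W: "weight_matrix W" and F: "\<And>m. m \<in> S \<Longrightarrow> poly_entries (F m)"
  shows "sandwich_integral (\<lambda>x. mat 1) W (\<lambda>x. \<Sum>m\<in>S. F m x ** D m)
    = (\<Sum>m\<in>S. sandwich_integral (\<lambda>x. mat 1) W (F m) ** D m)"
proof -
  have int: "cm_integrable (\<lambda>E. W E $ a $ d) (\<lambda>x. F m x $ d $ e * c)" if m: "m \<in> S" for a d e c m
  proof -
    obtain p where "\<forall>x. F m x $ d $ e = poly p (of_real x)"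
      using F[OF m] unfolding poly_entries_def by blast
    then show ?thesis
      using cm_integrable_poly[OF W] by (intro cm_integrable_mult_right) simp
  qed
  have "sandwich_integral (\<lambda>x. mat 1) W (\<lambda>x. \<Sum>m\<in>S. F m x ** D m) $ a $ b
      = (\<Sum>m\<in>S. sandwich_integral (\<lambda>x. mat 1) W (F m) ** D m) $ a $ b" for a b
  proof -
    have "sandwich_integral (\<lambda>x. mat 1) W (\<lambda>x. \<Sum>m\<in>S. F m x ** D m) $ a $ b
        = (\<Sum>d\<in>UNIV. \<Sum>m\<in>S. \<Sum>e\<in>UNIV. cm_integral (\<lambda>E. W E $ a $ d) (\<lambda>x. F m x $ d $ e) * D m $ e $ b)"
      unfolding sandwich_integral_left_1 sum_component matrix_mult_entry
      by (simp add: cm_integral_sum cm_integrable_sum int cm_integral_mult_right)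
    also have "\<dots> = (\<Sum>m\<in>S. \<Sum>e\<in>UNIV. (\<Sum>d\<in>UNIV. cm_integral (\<lambda>E. W E $ a $ d) (\<lambda>x. F m x $ d $ e)) * D m $ e $ b)"
      unfolding sum_distrib_right by (subst sum.swap, rule sum.cong[OF refl], rule sum.swap)
    finally show ?thesis
      by (simp add: matrix_mult_entry sandwich_integral_left_1)
  qed
  then show ?thesis by (simp add: vec_eq_iff)
qed

text \<open>Expand \<open>x ^ n\<close> times \<open>P v\<close> in the family and integrate: as
  \<open>P v\<close> is the identity, orthogonality to it removes every term except
  \<open>m = v\<close>.\<close>

lemma associated_weight_moments:
  fixes A B C :: "int \<Rightarrow> ('n::finite) supmat"
  assumes W: "weight_matrix W" and P: "generated_polys V (block_tridiagonal A B C) v P" and v: "v \<in> V"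
    and orth: "\<forall>i\<in>V. \<forall>j\<in>V. i \<noteq> j \<longrightarrow> sandwich_integral (\<lambda>x. ctranspose (P i x)) W (\<lambda>x. P j x) = 0"
    and poly: "\<And>m. m \<in> V \<Longrightarrow> poly_entries (P m)"
  shows "mat_integral W (\<lambda>x. of_real (x ^ n))
    = mat_integral W (\<lambda>x. 1) ** block_power V (block_tridiagonal A B C) n v v"
proof -
  let ?D = "block_power V (block_tridiagonal A B C) n"
  let ?S = "V \<inter> {v - int n..v + int n}"
  have Pv: "P v x = mat 1" for x
    using P by (simp add: generated_polys_def)
  have ct: "ctranspose (mat 1) = (mat 1 :: 'n supmat)"
    by (simp add: vec_eq_iff ctranspose_def mat_def)
  have "mat_integral W (\<lambda>x. of_real (x ^ n)) = sandwich_integral (\<lambda>x. mat 1) W (\<lambda>x. (x ^ n) *\<^sub>R P v x)"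
    by (simp only: Pv sandwich_integral_scaled_mat_1)
  also have "\<dots> = (\<Sum>m\<in>?S. sandwich_integral (\<lambda>x. mat 1) W (P m) ** ?D m v)"
    by (simp only: generated_polys_power[OF P v]) (rule sandwich_integral_sum_mult[OF W poly], auto)
  also have "\<dots> = (\<Sum>m\<in>?S. if m = v then sandwich_integral (\<lambda>x. mat 1) W (P v) ** ?D v v else 0)"
  proof (rule sum.cong[OF refl])
    fix m assume m: "m \<in> ?S"
    then have "sandwich_integral (\<lambda>x. mat 1) W (P m) = 0" if "m \<noteq> v"
      using orth[rule_format, OF v, of m] that by (simp add: Pv ct)
    then show "sandwich_integral (\<lambda>x. mat 1) W (P m) ** ?D m v
        = (if m = v then sandwich_integral (\<lambda>x. mat 1) W (P v) ** ?D v v else 0)"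
      by auto
  qed
  also have "\<dots> = sandwich_integral (\<lambda>x. mat 1) W (P v) ** ?D v v"
    using v by (subst sum.delta) auto
  also have "sandwich_integral (\<lambda>x. mat 1) W (P v) = mat_integral W (\<lambda>x. 1)"
    using sandwich_integral_scaled_mat_1[of W 0] by (simp add: Pv[abs_def])
  finally show ?thesis .
qed

text \<open>\<open>Q\<^sup>\<alpha>\<close> is the identity at the vertex \<open>base_vertex \<alpha>\<close> and vanishes at the other one.\<close>

definition base_vertex :: "2 \<Rightarrow> int" where
  "base_vertex \<alpha> = (if \<alpha> = 1 then 0 else -1)"

text \<open>At the two base vertices each polynomial is the identity or 0, so the double sum of the
  spectral representation collapses to a single block.\<close>

lemma spectral_block_matrix_moments:
  assumes "spectral_block_matrix A B C R W"
  shows "block_power UNIV (block_tridiagonal A B C) n (base_vertex \<alpha>) (base_vertex \<beta>) =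
    matrix_inv (ctranspose (R (base_vertex \<alpha>)) ** R (base_vertex \<alpha>)) **
      mat_integral (wblock W \<alpha> \<beta>) (\<lambda>x. of_real (x ^ n))"
proof -
  let ?i = "base_vertex \<beta>" and ?j = "base_vertex \<alpha>"
  obtain Q where Q: "two_sided_polys A B C Q"
    and rep: "\<And>i j n. block_power UNIV (block_tridiagonal A B C) n j i =
           (\<Sum>\<alpha>\<in>UNIV. \<Sum>\<beta>\<in>UNIV. matrix_inv (ctranspose (R j) ** R j) **
              sandwich_integral (\<lambda>x. (x ^ n) *\<^sub>R ctranspose (Q \<alpha> j x)) (wblock W \<alpha> \<beta>) (\<lambda>x. Q \<beta> i x))"
    using assms unfolding spectral_block_matrix_def by blast
  have val: "Q \<gamma> (base_vertex \<delta>) x = (if \<gamma> = \<delta> then mat 1 else 0)" for \<gamma> \<delta> x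
    using Q exhaust_2[of \<gamma>] exhaust_2[of \<delta>] by (auto simp: two_sided_polys_def base_vertex_def)
  have ct: "ctranspose (mat 1 :: 'a supmat) = mat 1" "ctranspose (0 :: 'a supmat) = 0"
    by (auto simp: vec_eq_iff ctranspose_def mat_def)
  have sw: "sandwich_integral (\<lambda>x. (x ^ n) *\<^sub>R ctranspose (Q \<gamma> ?j x)) (wblock W \<gamma> \<delta>) (\<lambda>x. Q \<delta> ?i x)
      = (if \<gamma> = \<alpha> then if \<delta> = \<beta> then mat_integral (wblock W \<alpha> \<beta>) (\<lambda>x. of_real (x ^ n)) else 0 else 0)" for \<gamma> \<delta>
  proof (cases "\<gamma> = \<alpha> \<and> \<delta> = \<beta>")
    case True
    then show ?thesis
      by (simp only: val ct simp_thms if_True sandwich_integral_mat_1_scaled)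
  next
    case False
    then show ?thesis by (auto simp: val ct sandwich_integral_def vec_eq_iff)
  qed
  have "block_power UNIV (block_tridiagonal A B C) n ?j ?i =
      (\<Sum>\<gamma>\<in>UNIV. if \<gamma> = \<alpha> then \<Sum>\<delta>\<in>UNIV. if \<delta> = \<beta> then
        matrix_inv (ctranspose (R ?j) ** R ?j) ** mat_integral (wblock W \<alpha> \<beta>) (\<lambda>x. of_real (x ^ n)) else 0 else 0)"
    unfolding rep sw
  proof (rule sum.cong[OF refl])
    fix \<gamma> :: 2
    let ?S = "matrix_inv (ctranspose (R ?j) ** R ?j)"
    let ?M = "mat_integral (wblock W \<alpha> \<beta>) (\<lambda>x. of_real (x ^ n))"
    have "?S ** (if \<delta> = \<beta> then ?M else 0) = (if \<delta> = \<beta> then ?S ** ?M else 0)" for \<delta>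
      by simp
    then show "(\<Sum>\<delta>\<in>UNIV. ?S ** (if \<gamma> = \<alpha> then if \<delta> = \<beta> then ?M else 0 else 0))
      = (if \<gamma> = \<alpha> then \<Sum>\<delta>\<in>UNIV. if \<delta> = \<beta> then ?S ** ?M else 0 else 0)"
      by (cases "\<gamma> = \<alpha>") (simp_all only: if_True if_False simp_thms matrix_mul_rzero sum.neutral_const)
  qed
  then show ?thesis by simp
qed

section \<open>Transforms of moment sequences\<close>

definition gen_term :: "complex \<Rightarrow> (nat \<Rightarrow> complex^'a^'b) \<Rightarrow> nat \<Rightarrow> complex^'a^'b" where
  "gen_term z D n = (\<chi> a b. D n $ a $ b / z ^ Suc n)"

text \<open>\<open>X\<close> is the analytic continuation to the complement of the real line of \<open>\<Sum>n. D n / z ^ (n + 1)\<close>.\<close>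

definition transform_of :: "(nat \<Rightarrow> complex^'a^'b) \<Rightarrow> (complex \<Rightarrow> complex^'a^'b) \<Rightarrow> bool" where
  "transform_of D X \<longleftrightarrow> mat_holomorphic X \<and> (\<forall>z. 4 < cmod z \<longrightarrow> mat_abs_sums (gen_term z D) (X z))"

lemma gen_term_mult: "gen_term z (\<lambda>n. M ** D n) = (\<lambda>n. M ** gen_term z D n)"
  by (simp add: fun_eq_iff gen_term_def vec_eq_iff matrix_mult_entry sum_divide_distrib)

text \<open>The inhomogeneous term of the off-diagonal equations, whose target vertex lies outside
  the half-line of the start.\<close>

lemma transform_of_0: "transform_of (\<lambda>n. 0) (\<lambda>z. 0)"
  by (simp add: transform_of_def mat_holomorphic_def mat_abs_sums_def abs_sums_def gen_term_def)

lemma transform_of_stieltjes: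
  assumes supp: "\<And>a b. supported_in_2 (\<lambda>E. W E $ a $ b)"
    and mom: "\<And>n. D n = M ** mat_integral W (\<lambda>x. of_real (x ^ n))"
  shows "transform_of D (\<lambda>z. M ** stieltjes z W)"
  unfolding transform_of_def
proof (intro conjI allI impI)
  show "mat_holomorphic (\<lambda>z. M ** stieltjes z W)"
    by (rule mat_holomorphic_mult[OF mat_holomorphic_const])
      (simp add: mat_holomorphic_def stieltjes_def mat_integral_def supported_holomorphic[OF supp])
  show "mat_abs_sums (gen_term z D) (M ** stieltjes z W)" if "4 < cmod z" for z
    unfolding mom[abs_def] gen_term_mult
    by (rule mat_abs_sums_mult_left)
      (simp add: mat_abs_sums_def gen_term_def stieltjes_def mat_integral_def
        supported_abs_sums[OF supp that, unfolded power_Suc] del: of_real_power)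
qed

text \<open>The crossing edge uses one step, and each series carries one extra factor
  \<open>1 / z\<close>: the exponents \<open>Suc k\<close> and \<open>Suc (n - 1 - k)\<close> add up
  to \<open>Suc n\<close>, so the convolution turns into a product without a correction
  factor.\<close>

lemma transform_of_convolution:
  fixes X S Y Z :: "complex \<Rightarrow> complex^'a^'a"
  assumes X: "transform_of D X" and S: "transform_of E S" and Y: "transform_of F Y" and Z: "transform_of G Z"
    and conv: "\<And>n. D n = E n + (\<Sum>k<n. F (n - 1 - k) ** M ** G k)" and z: "z \<notin> \<real>"
  shows "X z = S z + Y z ** M ** Z z"
proof (rule mat_holomorphic_eqI[where r = 4, OF _ _ _ z])
  show "mat_holomorphic X" "mat_holomorphic (\<lambda>z. S z + Y z ** M ** Z z)"
    using assms by (auto simp: transform_of_def intro!: mat_holomorphic_add mat_holomorphic_mult mat_holomorphic_const)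
  fix z :: complex assume z: "4 < cmod z"
  have Z': "mat_abs_sums (gen_term z (\<lambda>n. M ** G n)) (M ** Z z)"
    unfolding gen_term_mult using Z z by (intro mat_abs_sums_mult_left) (simp add: transform_of_def)
  have Y': "mat_abs_sums (gen_term z F) (Y z)"
    using Y z by (simp add: transform_of_def)
  have "X z $ a $ b = (S z + Y z ** M ** Z z) $ a $ b" for a b
  proof -
    define c where "c = (\<lambda>n. (D n $ a $ b - E n $ a $ b) / z ^ Suc n)"
    have "c sums (X z $ a $ b - S z $ a $ b)"
      using X S z unfolding c_def diff_divide_distrib
      by (intro sums_diff) (auto simp: transform_of_def mat_abs_sums_def abs_sums_def gen_term_def)
    \<comment> \<open>The convolution is empty at \<open>n = 0\<close>, so the series may be shifted
      by one to match the Cauchy product.\<close>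
    moreover have "c 0 = 0"
      by (simp add: c_def conv)
    ultimately have c: "(\<lambda>n. c (Suc n)) sums (X z $ a $ b - S z $ a $ b)"
      by (simp add: sums_Suc_iff)
    have "c (Suc n) = (\<Sum>k\<le>n. gen_term z F k ** gen_term z (\<lambda>n. M ** G n) (n - k)) $ a $ b" for n
    proof -
      have "(\<Sum>k<Suc n. F (n - k) ** M ** G k) = (\<Sum>k\<le>n. F k ** (M ** G (n - k)))"
        unfolding matrix_mul_assoc
        by (rule sum.reindex_bij_witness[of _ "\<lambda>k. n - k" "\<lambda>k. n - k"]) auto
      then have "D (Suc n) - E (Suc n) = (\<Sum>k\<le>n. F k ** (M ** G (n - k)))"
        by (simp add: conv)
      then have "c (Suc n) = (\<Sum>k\<le>n. (F k ** (M ** G (n - k))) $ a $ b / z ^ Suc (Suc n))"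
        unfolding c_def vector_minus_component[symmetric] by (simp only: sum_component sum_divide_distrib)
      also have "\<dots> = (\<Sum>k\<le>n. (gen_term z F k ** gen_term z (\<lambda>n. M ** G n) (n - k)) $ a $ b)"
      proof (rule sum.cong[OF refl])
        fix k assume "k \<in> {..n}"
        then have "z ^ Suc (Suc n) = z ^ Suc k * z ^ Suc (n - k)"
          by (subst power_add[symmetric]) simp
        then show "(F k ** (M ** G (n - k))) $ a $ b / z ^ Suc (Suc n)
            = (gen_term z F k ** gen_term z (\<lambda>n. M ** G n) (n - k)) $ a $ b"
          unfolding matrix_mult_entry[of "F k"] matrix_mult_entry[of "gen_term z F k"]
          by (simp only: sum_divide_distrib gen_term_def vec_lambda_beta times_divide_times_eq)
      qed
      finally show ?thesis by simp
    qed
    then have "(\<lambda>n. c (Suc n)) sums (Y z ** (M ** Z z)) $ a $ b"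
      using mat_sums_Cauchy_product[OF Y' Z'] by simp
    then have "(Y z ** (M ** Z z)) $ a $ b = X z $ a $ b - S z $ a $ b"
      using c sums_unique2 by blast
    then show ?thesis by (simp add: matrix_mul_assoc)
  qed
  then show "X z = S z + Y z ** M ** Z z" by (simp add: vec_eq_iff)
qed

text \<open>Moments are a fixed matrix times block powers and thus inherit their uniform
  bound.\<close>

lemma bounded_matrix_mult:
  fixes S :: "complex^'a^'b" and D :: "nat \<Rightarrow> complex^'c^'a"
  assumes "\<And>n a b. cmod (D n $ a $ b) \<le> K"
  shows "\<exists>L. \<forall>n a b. cmod ((S ** D n) $ a $ b) \<le> L"
proof (intro exI allI)
  fix n a b
  have "cmod ((S ** D n) $ a $ b) \<le> (\<Sum>c\<in>UNIV. cmod (S $ a $ c) * K)"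
    unfolding matrix_mult_entry
    by (rule order_trans[OF norm_sum]) (auto simp: norm_mult intro!: sum_mono mult_left_mono assms)
  also have "\<dots> \<le> (\<Sum>a\<in>UNIV. \<Sum>c\<in>UNIV. cmod (S $ a $ c) * K)"
    using order_trans[OF norm_ge_zero assms] by (intro member_le_sum sum_nonneg) auto
  finally show "cmod ((S ** D n) $ a $ b) \<le> (\<Sum>a\<in>UNIV. \<Sum>c\<in>UNIV. cmod (S $ a $ c) * K)" .
qed

text \<open>Polynomiality enters as the hypothesis \<open>poly\<close> because its proof differs for
  the two half-lines.\<close>

lemma associated_weight_transform:
  fixes A B C :: "int \<Rightarrow> ('n::finite) supmat"
  assumes Q: "quantum_markov_chain UNIV (block_tridiagonal A B C)" and v: "v \<in> V"
    and W: "associated_weight V (block_tridiagonal A B C) v W"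
    and poly: "\<And>P m. generated_polys V (block_tridiagonal A B C) v P \<Longrightarrow> m \<in> V \<Longrightarrow> poly_entries (P m)"
  shows "transform_of (\<lambda>n. block_power V (block_tridiagonal A B C) n v v)
    (\<lambda>z. matrix_inv (mat_integral W (\<lambda>_. 1)) ** stieltjes z W)"
proof -
  let ?D = "\<lambda>n. block_power V (block_tridiagonal A B C) n v v" and ?S = "mat_integral W (\<lambda>_. 1)"
  obtain P where wm: "weight_matrix W" and P: "generated_polys V (block_tridiagonal A B C) v P"
    and orth: "\<forall>i\<in>V. \<forall>j\<in>V. i \<noteq> j \<longrightarrow> sandwich_integral (\<lambda>x. ctranspose (P i x)) W (\<lambda>x. P j x) = 0"
    using W unfolding associated_weight_def by blast
  note mom = associated_weight_moments[OF wm P v orth poly[OF P]]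
  obtain K where K: "\<And>n a b. cmod ((?S ** ?D n) $ a $ b) \<le> K"
    using bounded_matrix_mult[of ?D 8 ?S] block_power_bounded[OF Q v v] by blast
  show ?thesis
  proof (rule transform_of_stieltjes)
    show "supported_in_2 (\<lambda>E. W E $ a $ b)" for a b
      by (rule weight_matrix_supported[OF wm, of K]) (simp only: mom K)
    show "?D n = matrix_inv ?S ** mat_integral W (\<lambda>x. of_real (x ^ n))" for n
    proof -
      have "matrix_inv ?S ** ?S = mat 1"
        using W by (intro matrix_inv_left) (simp add: associated_weight_def)
      then show ?thesis
        by (simp only: mom matrix_mul_assoc matrix_mul_lid)
    qed
  qed
qed

lemma ctranspose_mult: "ctranspose (M ** L) = ctranspose L ** ctranspose (M :: complex^'a^'b)"
  by (simp add: vec_eq_iff ctranspose_def matrix_mult_entry mult.commute)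

lemma invertible_ctranspose:
  assumes "invertible (M :: complex^'a^'a)"
  shows "invertible (ctranspose M)"
proof -
  have "ctranspose (mat 1) = (mat 1 :: complex^'a^'a)"
    by (simp add: vec_eq_iff ctranspose_def mat_def)
  then show ?thesis
    using assms unfolding invertible_def by (metis ctranspose_mult)
qed

text \<open>The diagonal entries of \<open>W\<close> lie in its diagonal blocks, so bounds on the
  return powers at the two base vertices control the support of all four blocks.\<close>

lemma spectral_block_matrix_transform:
  fixes A B C R :: "int \<Rightarrow> ('n::finite) supmat"
  assumes Q: "quantum_markov_chain UNIV (block_tridiagonal A B C)"
    and R: "\<And>n. invertible (R n)" and W: "spectral_block_matrix A B C R W"
  shows "transform_of
    (\<lambda>n. block_power UNIV (block_tridiagonal A B C) n (base_vertex \<alpha>) (base_vertex \<beta>))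
    (\<lambda>z. matrix_inv (ctranspose (R (base_vertex \<alpha>)) ** R (base_vertex \<alpha>)) ** stieltjes z (wblock W \<alpha> \<beta>))"
proof -
  let ?D = "\<lambda>\<alpha> n. block_power UNIV (block_tridiagonal A B C) n (base_vertex \<alpha>) (base_vertex \<alpha>)"
  define S where "S \<alpha> = ctranspose (R (base_vertex \<alpha>)) ** R (base_vertex \<alpha>)" for \<alpha>
  have inv: "invertible (S \<alpha>)" for \<alpha>
    unfolding S_def by (intro invertible_mult invertible_ctranspose R)
  note mom = spectral_block_matrix_moments[OF W, folded S_def]
  have diag: "mat_integral (wblock W \<alpha> \<alpha>) (\<lambda>x. of_real (x ^ n)) = S \<alpha> ** ?D \<alpha> n" for n \<alpha>
    unfolding mom by (simp add: matrix_mul_assoc matrix_inv_right[OF inv])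
  have "\<forall>\<alpha>. \<exists>K. \<forall>n a b. cmod ((S \<alpha> ** ?D \<alpha> n) $ a $ b) \<le> K"
    using bounded_matrix_mult[of "?D _" 8] block_power_bounded[OF Q] by blast
  then obtain K where K: "\<And>\<alpha> n a b. cmod ((S \<alpha> ** ?D \<alpha> n) $ a $ b) \<le> K \<alpha>"
    by metis
  have "cmod (mat_integral W (\<lambda>x. of_real (x ^ n)) $ p $ p) \<le> Max (range K)" for p n
  proof -
    obtain \<alpha> a where p: "p = (\<alpha>, a)" by (cases p)
    have eq: "mat_integral W (\<lambda>x. of_real (x ^ n)) $ p $ p = (S \<alpha> ** ?D \<alpha> n) $ a $ a"
      unfolding diag[symmetric] by (simp add: p mat_integral_def wblock_def)
    have "K \<alpha> \<le> Max (range K)" by simp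
    then show ?thesis
      unfolding eq by (rule order_trans[OF K])
  qed
  then have "supported_in_2 (\<lambda>E. W E $ p $ q)" for p q
    using W by (intro weight_matrix_supported) (auto simp: spectral_block_matrix_def)
  then have "supported_in_2 (\<lambda>E. wblock W \<alpha> \<beta> E $ a $ b)" for a b
    by (simp add: wblock_def)
  then show ?thesis
    unfolding S_def[symmetric] using mom by (rule transform_of_stieltjes)
qed

section \<open>The first passage equations and their solution\<close>

theorem mainTheorem6:
  fixes A B C E R :: "int \<Rightarrow> complex^('n::finite \<times> 'n)^('n \<times> 'n)"
    and W :: "real set \<Rightarrow> complex^(2 \<times> 'n \<times> 'n)^(2 \<times> 'n \<times> 'n)"
    and Wplus Wminus :: "real set \<Rightarrow> complex^('n \<times> 'n)^('n \<times> 'n)"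
    and z :: complex
  assumes "quantum_markov_chain UNIV (block_tridiagonal A B C)"
    and "\<And>n. n \<ge> 0 \<Longrightarrow> invertible (A n)"
    and "\<And>n. n \<le> -1 \<Longrightarrow> invertible (C n)"
    and "\<And>n. hermitian (E n)"
    and "\<And>n. invertible (R n)"
    and "\<And>n. n \<ge> 0 \<Longrightarrow>
           ctranspose (A n) ** ctranspose (R (n + 1)) ** R (n + 1)
           = ctranspose (R n) ** R n ** C (n + 1)"
    and "\<And>n. n \<ge> 0 \<Longrightarrow>
           ctranspose (R (- n - 1)) ** R (- n - 1) ** C (- n)
           = ctranspose (A (- n - 1)) ** ctranspose (R (- n)) ** R (- n)"
    and "\<And>n. R n ** B n = E n ** R n"
    and "spectral_block_matrix A B C R W"
    and "associated_weight {0..} (block_tridiagonal A B C) 0 Wplus"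
    and "associated_weight {..-1} (block_tridiagonal A B C) (-1) Wminus"
    and "z \<notin> \<real>"
  shows
    "let Pi0 = matrix_inv (ctranspose (R 0) ** R 0);
         Pim1 = matrix_inv (ctranspose (R (-1)) ** R (-1));
         Gplus = matrix_inv (mat_integral Wplus (\<lambda>_. 1)) ** stieltjes z Wplus;
         Gminus = matrix_inv (mat_integral Wminus (\<lambda>_. 1)) ** stieltjes z Wminus;
         Dplus = mat 1 - A (-1) ** Gminus ** C 0 ** Gplus;
         Dminus = mat 1 - C 0 ** Gplus ** A (-1) ** Gminus
     in invertible Dplus \<and> invertible Dminus \<and>
        Pi0 ** stieltjes z (wblock W 1 1) = Gplus ** matrix_inv Dplus \<and>
        Pim1 ** stieltjes z (wblock W 2 2) = Gminus ** matrix_inv Dminus \<and>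
        Pi0 ** stieltjes z (wblock W 1 2) = Gplus ** matrix_inv Dplus ** A (-1) ** Gminus \<and>
        Pim1 ** stieltjes z (wblock W 2 1) = Gminus ** matrix_inv Dminus ** C 0 ** Gplus"
proof -
  let ?T = "block_tridiagonal A B C"
  let ?X = "\<lambda>\<alpha> \<beta> z. matrix_inv (ctranspose (R (base_vertex \<alpha>)) ** R (base_vertex \<alpha>)) ** stieltjes z (wblock W \<alpha> \<beta>)"
  define Gplus where "Gplus = (\<lambda>z. matrix_inv (mat_integral Wplus (\<lambda>_. 1)) ** stieltjes z Wplus)"
  define Gminus where "Gminus = (\<lambda>z. matrix_inv (mat_integral Wminus (\<lambda>_. 1)) ** stieltjes z Wminus)"
  note Q = assms(1)
  have T: "?T (-1) 0 = C 0" "?T 0 (-1) = A (-1)"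
    by (auto simp: block_tridiagonal_def)
  have X: "transform_of (\<lambda>n. block_power UNIV ?T n (base_vertex \<alpha>) (base_vertex \<beta>)) (?X \<alpha> \<beta>)" for \<alpha> \<beta>
    by (rule spectral_block_matrix_transform[OF Q assms(5,9)])
  have plus: "transform_of (\<lambda>n. block_power {0..} ?T n 0 0) Gplus"
    unfolding Gplus_def
  proof (rule associated_weight_transform[OF Q _ assms(10)])
    show "poly_entries (P m)" if "generated_polys {0..} ?T 0 P" "m \<in> {0..}" for P m
      using generated_polys_nonneg_poly[OF that(1) assms(2), of "nat m"] that(2) by simp
  qed simp
  have minus: "transform_of (\<lambda>n. block_power {..-1} ?T n (-1) (-1)) Gminus"
    unfolding Gminus_def
  proof (rule associated_weight_transform[OF Q _ assms(11)])
    show "poly_entries (P m)" if "generated_polys {..-1} ?T (-1) P" "m \<in> {..-1}" for P m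
      using generated_polys_neg_poly[OF that(1) assms(3), of "nat (- 1 - m)"] that(2) by simp
  qed simp
  \<comment> \<open>Steps have length at most one, so the nonnegative half-line is left only from 0
    to -1, with block \<open>C 0\<close>.\<close>
  have exit_plus: "block_power UNIV ?T n j 0 = (if j \<in> {0..} then block_power {0..} ?T n j 0 else 0)
      + (\<Sum>k<n. block_power UNIV ?T (n - 1 - k) j (-1) ** C 0 ** block_power {0..} ?T k 0 0)" for n j
    unfolding T(1)[symmetric] by (rule block_power_exit) (auto simp: block_tridiagonal_def)
  have exit_minus: "block_power UNIV ?T n j (-1) = (if j \<in> {..-1} then block_power {..-1} ?T n j (-1) else 0)
      + (\<Sum>k<n. block_power UNIV ?T (n - 1 - k) j 0 ** A (-1) ** block_power {..-1} ?T k (-1) (-1))" for n j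
    unfolding T(2)[symmetric] by (rule block_power_exit) (auto simp: block_tridiagonal_def)
  have X11: "?X 1 1 z = Gplus z + ?X 1 2 z ** C 0 ** Gplus z"
    by (intro transform_of_convolution[OF X plus X plus _ assms(12)])
      (simp add: base_vertex_def exit_plus[of _ 0])
  \<comment> \<open>The target -1 lies outside \<open>{0..}\<close>, so no path avoids the crossing
    and the inhomogeneous term is 0.\<close>
  have X21: "?X 2 1 z = 0 + ?X 2 2 z ** C 0 ** Gplus z"
    by (intro transform_of_convolution[OF X transform_of_0 X plus _ assms(12)])
      (simp add: base_vertex_def exit_plus[of _ "-1"])
  have X22: "?X 2 2 z = Gminus z + ?X 2 1 z ** A (-1) ** Gminus z"
    by (intro transform_of_convolution[OF X minus X minus _ assms(12)])
      (simp add: base_vertex_def exit_minus[of _ "-1"])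
  have X12: "?X 1 2 z = 0 + ?X 1 1 z ** A (-1) ** Gminus z"
    by (intro transform_of_convolution[OF X transform_of_0 X minus _ assms(12)])
      (simp add: base_vertex_def exit_minus[of _ 0])
  define x11 x12 x21 x22 where x: "x11 = ?X 1 1 z" "x12 = ?X 1 2 z" "x21 = ?X 2 1 z" "x22 = ?X 2 2 z"
  let ?Dp = "mat 1 - A (-1) ** Gminus z ** C 0 ** Gplus z"
  let ?Dm = "mat 1 - C 0 ** Gplus z ** A (-1) ** Gminus z"
  have s12: "x12 = x11 ** A (-1) ** Gminus z" and s21: "x21 = x22 ** C 0 ** Gplus z"
    using X12 X21 by (simp_all add: x)
  \<comment> \<open>Eliminating the off-diagonal block leaves one linear equation for each diagonal
    block.\<close>
  have s11: "x11 = Gplus z + x11 ** A (-1) ** Gminus z ** C 0 ** Gplus z"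
    using X11 unfolding x[symmetric] s12 .
  have s22: "x22 = Gminus z + x22 ** C 0 ** Gplus z ** A (-1) ** Gminus z"
    using X22 unfolding x[symmetric] s21 .
  \<comment> \<open>The roles are crossed: the equation for \<open>x22\<close> makes the matrix
    belonging to \<open>x11\<close> invertible, and conversely.\<close>
  have inv_p: "invertible ?Dp"
    using invertible_if_resolvent[where a = "A (-1)" and G = "Gminus z" and b = "C 0 ** Gplus z" and Y = x22] s22
    unfolding matrix_mul_assoc by blast
  have inv_m: "invertible ?Dm"
    using invertible_if_resolvent[where a = "C 0" and G = "Gplus z" and b = "A (-1) ** Gminus z" and Y = x11] s11
    unfolding matrix_mul_assoc by blast
  have e11: "x11 = Gplus z ** matrix_inv ?Dp"
    using eq_mult_matrix_inv[OF inv_p, of x11 "Gplus z"] s11 unfolding matrix_mul_assoc by blast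
  have e22: "x22 = Gminus z ** matrix_inv ?Dm"
    using eq_mult_matrix_inv[OF inv_m, of x22 "Gminus z"] s22 unfolding matrix_mul_assoc by blast
  have e12: "x12 = Gplus z ** matrix_inv ?Dp ** A (-1) ** Gminus z"
    unfolding s12 e11 ..
  have e21: "x21 = Gminus z ** matrix_inv ?Dm ** C 0 ** Gplus z"
    unfolding s21 e22 ..
  have bv: "base_vertex 1 = 0" "base_vertex 2 = -1"
    by (auto simp: base_vertex_def)
  show ?thesis
    unfolding Let_def
    using inv_p inv_m e11 e12 e21 e22 unfolding x bv Gplus_def Gminus_def by blast
qed

end
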